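(* Let $\mathcal{C} = \{C_{1}, \ldots, C_{k}\} \subset \mathbb{P}^{2}_{\mathbb{C}}$ be an arrangement of $k\geq 2$ smooth conics whose only singularities are $n_{2}$ nodes and $n_{3}$ ordinary triple points. Then the curve $\mathcal{C} : f = 0$ (where $f = \prod_{i} f_i$ is the product of the defining quadratic forms, a reduced curve of degree $d=2k$) is never nearly free.
   Context: Let $S=\mathbb{C}[x,y,z]$ and for a homogeneous reduced $f\in S$ of degree $d$ let $J_f=(\partial_x f,\partial_y f,\partial_z f)$ be the Jacobian ideal and $M(f)=S/J_f$ the Milnor algebra. The curve $C: f=0$ is called $m$-syzygy if $M(f)$ has a minimal graded free resolution of the form $0 \to \bigoplus_{i=1}^{m-2} S(-e_i) \to \bigoplus_{i=1}^{m} S(1-d-d_i) \to S^3(1-d) \to S$ with $e_1\le \dots\le e_{m-2}$ and $1\le d_1\le \dots \le d_m$. The curve $C$ is nearly free if it is $3$-syzygy with $d_1+d_2=d$, $d_2=d_3$ and $e_1=d+d_2$. An ordinary triple point is a point where three smooth branches meet with pairwise distinct tangents. *)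

theory Defs
  imports "HOL-Analysis.Analysis"
begin

text \<open>Elements of S = C[x,y,z] are represented by the polynomial functions
  C^3 -> C they define (faithful since C is infinite).\<close>

type_synonym pf = "complex \<Rightarrow> complex \<Rightarrow> complex \<Rightarrow> complex"

definition zero_pf :: pf where "zero_pf = (\<lambda>x y z. 0)"

definition polyS :: "pf set" where
  "polyS = {f. \<exists>N (c :: nat \<Rightarrow> nat \<Rightarrow> nat \<Rightarrow> complex).
      f = (\<lambda>x y z. \<Sum>i\<le>N. \<Sum>j\<le>N. \<Sum>l\<le>N. c i j l * x^i * y^j * z^l)}"

text \<open>Homogeneous of degree d (an integer; the zero polynomial is homogeneous of
  every degree, and the only one of negative degree).\<close>
definition homog :: "int \<Rightarrow> pf \<Rightarrow> bool" where
  "homog d f \<longleftrightarrow> (if d < 0 then f = zero_pf else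
     (\<exists>c :: nat \<Rightarrow> nat \<Rightarrow> complex. f = (\<lambda>x y z. \<Sum>i\<le>nat d. \<Sum>j\<le>nat d.
        if i + j \<le> nat d then c i j * x^i * y^j * z^(nat d - i - j) else 0)))"

definition dX :: "pf \<Rightarrow> pf" where "dX f = (\<lambda>x y z. deriv (\<lambda>t. f t y z) x)"
definition dY :: "pf \<Rightarrow> pf" where "dY f = (\<lambda>x y z. deriv (\<lambda>t. f x t z) y)"
definition dZ :: "pf \<Rightarrow> pf" where "dZ f = (\<lambda>x y z. deriv (\<lambda>t. f x y t) z)"

definition jac :: "pf \<Rightarrow> nat \<Rightarrow> pf" where
  "jac f l = (if l = 0 then dX f else if l = 1 then dY f else dZ f)"

definition vecs :: "nat \<Rightarrow> (nat \<Rightarrow> pf) set" where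
  "vecs n = {u. \<forall>i<n. u i \<in> polyS}"

definition mapply :: "(nat \<Rightarrow> nat \<Rightarrow> pf) \<Rightarrow> nat \<Rightarrow> (nat \<Rightarrow> pf) \<Rightarrow> nat \<Rightarrow> pf" where
  "mapply M n u l = (\<lambda>x y z. \<Sum>j<n. M l j x y z * u j x y z)"

text \<open>M(f) = S/J_f has a minimal graded free resolution
  0 -> (+)_{i<m-2} S(-e_i) --A--> (+)_{j<m} S(1-d-d_j) --B--> S^3(1-d) --(f_x,f_y,f_z)--> S
  (0-based indices; degree-0 graded maps are matrices of homogeneous forms of the
  appropriate degrees; minimality = no nonzero constant entries).\<close>
definition syz_resolution :: "pf \<Rightarrow> nat \<Rightarrow> nat \<Rightarrow> (nat \<Rightarrow> nat) \<Rightarrow> (nat \<Rightarrow> nat) \<Rightarrow> bool" where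
  "syz_resolution f d m ds es \<longleftrightarrow>
     d \<ge> 2 \<and> m \<ge> 2 \<and> homog (int d) f \<and> f \<noteq> zero_pf \<and>
     (\<forall>i j. i \<le> j \<and> j < m \<longrightarrow> ds i \<le> ds j) \<and> (m > 0 \<longrightarrow> 1 \<le> ds 0) \<and>
     (\<forall>i j. i \<le> j \<and> j < m - 2 \<longrightarrow> es i \<le> es j) \<and>
     (\<exists>A B.
        (\<forall>l<3. \<forall>j<m. homog (int (ds j)) (B l j)) \<and>
        (\<forall>j<m. \<forall>i<m-2. homog (int (es i) - int (d - 1 + ds j)) (A j i)) \<and>
        (\<forall>j<m. \<forall>i<m-2. es i = d - 1 + ds j \<longrightarrow> A j i = zero_pf) \<and>
        (\<forall>j<m. (\<lambda>x y z. \<Sum>l<3. jac f l x y z * B l j x y z) = zero_pf) \<and>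
        (\<forall>u\<in>vecs 3. (\<lambda>x y z. \<Sum>l<3. jac f l x y z * u l x y z) = zero_pf \<longrightarrow>
            (\<exists>v\<in>vecs m. \<forall>l<3. u l = mapply B m v l)) \<and>
        (\<forall>l<3. \<forall>i<m-2. mapply B m (\<lambda>j. A j i) l = zero_pf) \<and>
        (\<forall>v\<in>vecs m. (\<forall>l<3. mapply B m v l = zero_pf) \<longrightarrow>
            (\<exists>w\<in>vecs (m-2). \<forall>j<m. v j = mapply A (m-2) w j)) \<and>
        (\<forall>w\<in>vecs (m-2). (\<forall>j<m. mapply A (m-2) w j = zero_pf) \<longrightarrow>
            (\<forall>i<m-2. w i = zero_pf)))"

definition m_syzygy :: "pf \<Rightarrow> nat \<Rightarrow> bool" where
  "m_syzygy f m \<longleftrightarrow> (\<exists>d ds es. syz_resolution f d m ds es)"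

definition nearly_free :: "pf \<Rightarrow> bool" where
  "nearly_free f \<longleftrightarrow> (\<exists>d ds es. syz_resolution f d 3 ds es \<and>
      ds 0 + ds 1 = d \<and> ds 1 = ds 2 \<and> es 0 = d + ds 1)"

definition is_sing_point :: "pf \<Rightarrow> complex \<Rightarrow> complex \<Rightarrow> complex \<Rightarrow> bool" where
  "is_sing_point f x y z \<longleftrightarrow> (x, y, z) \<noteq> (0, 0, 0) \<and> f x y z = 0 \<and>
     dX f x y z = 0 \<and> dY f x y z = 0 \<and> dZ f x y z = 0"

definition smooth_curve :: "pf \<Rightarrow> bool" where
  "smooth_curve f \<longleftrightarrow> (\<forall>x y z. \<not> is_sing_point f x y z)"

definition Dm :: "nat \<Rightarrow> nat \<Rightarrow> nat \<Rightarrow> pf \<Rightarrow> pf" where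
  "Dm a b c f = (dX ^^ a) ((dY ^^ b) ((dZ ^^ c) f))"

text \<open>Tangent cone at p of a point of multiplicity r (degree-r part of f(p+v)).\<close>
definition tangent_cone :: "pf \<Rightarrow> nat \<Rightarrow> complex \<Rightarrow> complex \<Rightarrow> complex \<Rightarrow> pf" where
  "tangent_cone f r x y z = (\<lambda>u v w. \<Sum>a\<le>r. \<Sum>b\<le>r. if a + b \<le> r then
      Dm a b (r - a - b) f x y z / of_nat (fact a * fact b * fact (r - a - b))
        * u^a * v^b * w^(r - a - b) else 0)"

definition proportional3 :: "complex \<times> complex \<times> complex \<Rightarrow> complex \<times> complex \<times> complex \<Rightarrow> bool" where
  "proportional3 L M \<longleftrightarrow> (\<exists>t. fst L = t * fst M \<and> fst (snd L) = t * fst (snd M)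
       \<and> snd (snd L) = t * snd (snd M))"

definition ordinary_mpoint :: "pf \<Rightarrow> nat \<Rightarrow> complex \<Rightarrow> complex \<Rightarrow> complex \<Rightarrow> bool" where
  "ordinary_mpoint f r x y z \<longleftrightarrow> (x, y, z) \<noteq> (0, 0, 0) \<and> f x y z = 0 \<and>
     (\<forall>a b c. a + b + c < r \<longrightarrow> Dm a b c f x y z = 0) \<and>
     (\<exists>(L :: nat \<Rightarrow> complex \<times> complex \<times> complex) (\<kappa> :: complex). \<kappa> \<noteq> 0 \<and>
        (\<forall>i<r. L i \<noteq> (0, 0, 0)) \<and>
        (\<forall>i<r. \<forall>j<r. i \<noteq> j \<longrightarrow> \<not> proportional3 (L i) (L j)) \<and>
        (\<forall>u v w. tangent_cone f r x y z u v w = \<kappa> * (\<Prod>i<r.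
            fst (L i) * u + fst (snd (L i)) * v + snd (snd (L i)) * w)))"

abbreviation is_node :: "pf \<Rightarrow> complex \<Rightarrow> complex \<Rightarrow> complex \<Rightarrow> bool" where
  "is_node f \<equiv> ordinary_mpoint f 2"

abbreviation is_ordinary_triple_point :: "pf \<Rightarrow> complex \<Rightarrow> complex \<Rightarrow> complex \<Rightarrow> bool" where
  "is_ordinary_triple_point f \<equiv> ordinary_mpoint f 3"

end

theory Submission
  imports Defs "HOL-Computational_Algebra.Fundamental_Theorem_Algebra"
begin

text \<open>
  A syzygy \<open>\<theta>\<close> of the partials of \<open>f\<close> is a vector field tangent to every conic, and is determined by the
  covector field \<open>W = v \<times> \<theta>\<close>. On a conic \<open>C\<^sub>i\<close>, identified with the projective line, a tangent field of degree
  \<open>m\<close> is a section of a line bundle of degree \<open>2 m\<close>, and it vanishes where \<open>C\<^sub>i\<close> meets another conic because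
  the crossings are transversal. Prescribing enough further zeros makes \<open>W\<close> divisible by the equation of \<open>C\<^sub>i\<close>,
  and one continues with the remaining conics. At most three conics pass through a point, so the \<open>i\<close>-th conic
  (counted from 0) has at least \<open>2 (k - 1 - i)\<close> crossings with later ones, and the last but one has 4; hence
  the syzygies of degree \<open>2 k - 2\<close> form a space of dimension at most \<open>k\<^sup>2 - 2\<close>. For a nearly free curve the
  resolution gives dimension \<open>k\<^sup>2 - 1 + (k - d\<^sub>1) (k - d\<^sub>1 - 1) \<ge> k\<^sup>2 - 1\<close>.
\<close>

section \<open>Homogeneous polynomial functions\<close>

text \<open>The margin is exact. At stage \<open>i\<close> the remaining covector field has degree
  \<open>2 * (k - i) - 1\<close>, so \<open>4 * (k - 1 - i) + 1\<close> zeros are needed on that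
  conic. If only the general number of crossings were used, \<open>2 * (k - 1 - i) + 1\<close> zeros
  would have to be prescribed, k^2 in all, which does not contradict the lower bound k^2 - 1; the
  two conditions saved on the last but one conic decide the matter. Syzygies of degree
  \<open>2 * k - 2\<close> are taken because \<open>W\<close> then has degree
  \<open>2 * k - 1\<close>, the largest degree that \<open>k\<close> divisions by quadratic forms
  push below zero. Passing from \<theta> to \<open>W\<close> removes the multiples of the Euler
  field, and on a conic tangency makes \<open>W\<close> a scalar multiple of the gradient, so a
  single polynomial in the parameter carries all of it. Only crossings with later conics help,
  because the quotient by an earlier form need not be tangent to that earlier conic. The dimension
  bound takes the form of a finite set of linear conditions that forces \<open>W\<close> to vanish;
  a nonzero syzygy meeting them exists as soon as there are more coefficients than
  conditions.\<close>

inductive hpoly :: "nat \<Rightarrow> (complex^3 \<Rightarrow> complex) \<Rightarrow> bool" where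
  hpoly_const: "hpoly 0 (\<lambda>v. c)"
| hpoly_coord: "hpoly n f \<Longrightarrow> hpoly (Suc n) (\<lambda>v. v $ i * f v)"
| hpoly_add: "hpoly n f \<Longrightarrow> hpoly n g \<Longrightarrow> hpoly n (\<lambda>v. f v + g v)"

lemma hpoly_zero: "hpoly n (\<lambda>v. 0)"
proof (induction n)
  case (Suc n)
  from hpoly_coord[OF this, of 1] show ?case by simp
qed (rule hpoly_const)

lemma hpoly_cmult: "hpoly n f \<Longrightarrow> hpoly n (\<lambda>v. c * f v)"
proof (induction rule: hpoly.induct)
  case (hpoly_coord n f i)
  from hpoly.hpoly_coord[OF this(2), of i] show ?case by (simp add: algebra_simps)
next
  case (hpoly_add n f g)
  from hpoly.hpoly_add[OF this(3,4)] show ?case by (simp add: algebra_simps)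
qed (rule hpoly.hpoly_const)

lemma hpoly_diff: "hpoly n f \<Longrightarrow> hpoly n g \<Longrightarrow> hpoly n (\<lambda>v. f v - g v)"
  using hpoly_add[of n f "\<lambda>v. -1 * g v"] hpoly_cmult[of n g "-1"] by simp

lemma hpoly_sum: "(\<And>i. i \<in> I \<Longrightarrow> hpoly n (f i)) \<Longrightarrow> hpoly n (\<lambda>v. \<Sum>i\<in>I. f i v)"
  by (induction I rule: infinite_finite_induct) (auto intro: hpoly_zero hpoly_add)

lemma hpoly_mult: "hpoly n f \<Longrightarrow> hpoly m g \<Longrightarrow> hpoly (n + m) (\<lambda>v. f v * g v)"
proof (induction rule: hpoly.induct)
  case (hpoly_const c)
  then show ?case by (simp add: hpoly_cmult)
next
  case (hpoly_coord n f i)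
  from hpoly.hpoly_coord[OF hpoly_coord.IH[OF hpoly_coord.prems], of i]
  show ?case by (simp add: algebra_simps)
next
  case (hpoly_add n f g)
  from hpoly.hpoly_add[OF hpoly_add.IH(1)[OF hpoly_add.prems] hpoly_add.IH(2)[OF hpoly_add.prems]]
  show ?case by (simp add: algebra_simps)
qed

lemma hpoly_nth_power: "hpoly n (\<lambda>v. (v $ i) ^ n)"
  by (induction n) (auto intro: hpoly_const hpoly_coord)

lemma hpoly_nth: "hpoly 1 (\<lambda>v. v $ i)"
  using hpoly_nth_power[of 1 i] by simp

lemma hpoly_prod: "(\<And>i. i \<in> I \<Longrightarrow> hpoly n (f i)) \<Longrightarrow> hpoly (n * card I) (\<lambda>v. \<Prod>i\<in>I. f i v)"
proof (induction I rule: infinite_finite_induct)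
  case (insert x F)
  have "hpoly (n + n * card F) (\<lambda>v. f x v * (\<Prod>i\<in>F. f i v))"
    using insert by (intro hpoly_mult) auto
  then show ?case using insert by simp
qed (auto intro: hpoly_const)

lemma hpoly_scale: "hpoly n f \<Longrightarrow> f (c *s v) = c ^ n * f v"
  by (induction rule: hpoly.induct) (auto simp: algebra_simps)

lemma hpoly_linear_subst:
  assumes "hpoly n f"
  shows "hpoly n (\<lambda>v. f (M *v v))"
  using assms
proof (induction rule: hpoly.induct)
  case (hpoly_coord n f i)
  have "hpoly (1 + n) (\<lambda>v. (\<Sum>j\<in>UNIV. M $ i $ j * v $ j) * f (M *v v))"
    by (intro hpoly_mult hpoly_sum hpoly_cmult hpoly_nth hpoly_coord.IH)
  then show ?case by (simp add: matrix_vector_mult_def)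
qed (auto intro: hpoly_const hpoly_add)

lemma hpoly_curve:
  assumes "hpoly n f" "\<And>i. \<exists>p. degree p \<le> m \<and> (\<forall>u. \<gamma> u $ i = poly p u)"
  shows "\<exists>p. degree p \<le> n * m \<and> (\<forall>u. f (\<gamma> u) = poly p u)"
  using assms(1)
proof (induction rule: hpoly.induct)
  case (hpoly_const c)
  show ?case by (rule exI[of _ "[:c:]"]) simp
next
  case (hpoly_coord n f i)
  obtain p where p: "degree p \<le> n * m" "\<And>u. f (\<gamma> u) = poly p u" using hpoly_coord by auto
  obtain p' where p': "degree p' \<le> m" "\<And>u. \<gamma> u $ i = poly p' u" using assms(2) by blast
  have "degree (p' * p) \<le> Suc n * m"
    using degree_mult_le[of p' p] p p' by simp
  then show ?case using p p' by (intro exI[of _ "p' * p"]) auto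
next
  case (hpoly_add n f g)
  then obtain p p' where "degree p \<le> n * m" "\<And>u. f (\<gamma> u) = poly p u"
    "degree p' \<le> n * m" "\<And>u. g (\<gamma> u) = poly p' u" by metis
  then show ?case by (intro exI[of _ "p + p'"]) (auto intro: degree_add_le)
qed

lemma hpoly_line:
  assumes "hpoly n f"
  shows "\<exists>p. \<forall>u. f (v + u *s w) = poly p u"
proof -
  have "\<exists>p. degree p \<le> 1 \<and> (\<forall>u. (v + u *s w) $ i = poly p u)" for i
    by (rule exI[of _ "[:v $ i, w $ i:]"]) auto
  from hpoly_curve[OF assms this] show ?thesis by blast
qed

text \<open>Restriction to the line through \<open>v\<close> and \<open>v0\<close> reduces this to
  the absence of zero divisors among polynomials in one variable. It serves to cancel a nonzero
  form.\<close>

lemma hpoly_mult_eq_zeroD: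
  assumes "hpoly n f" "hpoly m g" "\<And>v. f v * g v = 0" "f v0 \<noteq> 0"
  shows "g v = 0"
proof -
  obtain p where p: "\<And>u. f (v + u *s (v0 - v)) = poly p u" using hpoly_line[OF assms(1)] by blast
  obtain p' where p': "\<And>u. g (v + u *s (v0 - v)) = poly p' u" using hpoly_line[OF assms(2)] by blast
  have "poly (p * p') = poly 0" using assms(3) p p' by (auto simp: fun_eq_iff) (metis mult_eq_0_iff)
  then have "p * p' = 0" by (simp only: poly_eq_poly_eq_iff)
  moreover have "p \<noteq> 0" using p[of 1] assms(4) by auto
  ultimately show ?thesis using p'[of 0] by simp
qed

text \<open>Integer degrees, with only the zero function in negative degrees, let quotients of forms
  be treated uniformly.\<close>

definition hp :: "int \<Rightarrow> (complex^3 \<Rightarrow> complex) \<Rightarrow> bool" where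
  "hp d f \<longleftrightarrow> (if d < 0 then f = (\<lambda>v. 0) else hpoly (nat d) f)"

lemma hp_imp_hpoly: "hp d f \<Longrightarrow> \<exists>n. hpoly n f"
  by (auto simp: hp_def hpoly_zero split: if_splits)

lemma hp_add: "hp d f \<Longrightarrow> hp d g \<Longrightarrow> hp d (\<lambda>v. f v + g v)"
  by (auto simp: hp_def hpoly_add split: if_splits)

lemma hp_zero: "hp d (\<lambda>v. 0)"
  by (auto simp: hp_def hpoly_zero)

lemma hp_coord: "hp d f \<Longrightarrow> hp (d + 1) (\<lambda>v. v $ i * f v)"
  using hpoly_coord[of "nat d" f i] hpoly_zero[of 0]
  by (auto simp: hp_def nat_add_distrib split: if_splits)

lemma hp_linear_subst: "hp d f \<Longrightarrow> hp d (\<lambda>v. f (M *v v))"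
  by (auto simp: hp_def hpoly_linear_subst split: if_splits)

lemma hpoly_imp_hp: "hpoly n f \<Longrightarrow> d = int n \<Longrightarrow> hp d f"
  by (auto simp: hp_def)

text \<open>Division with remainder by \<open>v\<^sub>2\<^sup>2 - v\<^sub>1 v\<^sub>3\<close>, as a polynomial in the second coordinate.\<close>

lemma hpoly_standard_conic_remainder:
  assumes "hpoly n f"
  shows "\<exists>P R1 R0. hp (int n - 2) P \<and> hp (int n - 1) R1 \<and> hp (int n) R0 \<and>
    (\<forall>v w. v $ 1 = w $ 1 \<longrightarrow> v $ 3 = w $ 3 \<longrightarrow> R1 v = R1 w \<and> R0 v = R0 w) \<and>
    (\<forall>v. f v = ((v $ 2)\<^sup>2 - v $ 1 * v $ 3) * P v + v $ 2 * R1 v + R0 v)"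
  using assms
proof (induction rule: hpoly.induct)
  case (hpoly_const c)
  show ?case
    by (rule exI[of _ "\<lambda>v. 0"], rule exI[of _ "\<lambda>v. 0"], rule exI[of _ "\<lambda>v. c"])
       (auto simp: hp_zero intro: hpoly_imp_hp hpoly.hpoly_const)
next
  case (hpoly_add n f g)
  obtain P R1 R0 where *:
    "hp (int n - 2) P" "hp (int n - 1) R1" "hp (int n) R0"
    "\<forall>v w. v $ 1 = w $ 1 \<longrightarrow> v $ 3 = w $ 3 \<longrightarrow> R1 v = R1 w \<and> R0 v = R0 w"
    "\<forall>v. f v = ((v $ 2)\<^sup>2 - v $ 1 * v $ 3) * P v + v $ 2 * R1 v + R0 v"
    using hpoly_add.IH(1) by (elim exE conjE) (rule that)
  obtain P' R1' R0' where **: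
    "hp (int n - 2) P'" "hp (int n - 1) R1'" "hp (int n) R0'"
    "\<forall>v w. v $ 1 = w $ 1 \<longrightarrow> v $ 3 = w $ 3 \<longrightarrow> R1' v = R1' w \<and> R0' v = R0' w"
    "\<forall>v. g v = ((v $ 2)\<^sup>2 - v $ 1 * v $ 3) * P' v + v $ 2 * R1' v + R0' v"
    using hpoly_add.IH(2) by (elim exE conjE) (rule that)
  from *(4) **(4) have "\<forall>v w. v $ 1 = w $ 1 \<longrightarrow> v $ 3 = w $ 3 \<longrightarrow>
      R1 v + R1' v = R1 w + R1' w \<and> R0 v + R0' v = R0 w + R0' w"
    by metis
  moreover have "\<forall>v. f v + g v = ((v $ 2)\<^sup>2 - v $ 1 * v $ 3) * (P v + P' v) + v $ 2 * (R1 v + R1' v) + (R0 v + R0' v)"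
    unfolding *(5)[rule_format] **(5)[rule_format] by (simp add: algebra_simps)
  ultimately show ?case
    using hp_add[OF *(1) **(1)] hp_add[OF *(2) **(2)] hp_add[OF *(3) **(3)] by blast
next
  case (hpoly_coord n f i)
  obtain P R1 R0 where *:
    "hp (int n - 2) P" "hp (int n - 1) R1" "hp (int n) R0"
    "\<forall>v w. v $ 1 = w $ 1 \<longrightarrow> v $ 3 = w $ 3 \<longrightarrow> R1 v = R1 w \<and> R0 v = R0 w"
    "\<forall>v. f v = ((v $ 2)\<^sup>2 - v $ 1 * v $ 3) * P v + v $ 2 * R1 v + R0 v"
    using hpoly_coord.IH by (elim exE conjE) (rule that)
  have i: "i = 1 \<or> i = 2 \<or> i = 3" using exhaust_3 by blast
  show ?case
  proof (cases "i = 2")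
    case False
    have "hp (int (Suc n) - 2) (\<lambda>v. v $ i * P v)" "hp (int (Suc n) - 1) (\<lambda>v. v $ i * R1 v)"
      "hp (int (Suc n)) (\<lambda>v. v $ i * R0 v)"
      using hp_coord[OF *(1), of i] hp_coord[OF *(2), of i] hp_coord[OF *(3), of i]
      by (simp_all add: algebra_simps)
    moreover have "\<forall>v w. v $ 1 = w $ 1 \<longrightarrow> v $ 3 = w $ 3 \<longrightarrow>
        v $ i * R1 v = w $ i * R1 w \<and> v $ i * R0 v = w $ i * R0 w"
      using *(4) i False by metis
    moreover have "\<forall>v. v $ i * f v =
        ((v $ 2)\<^sup>2 - v $ 1 * v $ 3) * (v $ i * P v) + v $ 2 * (v $ i * R1 v) + v $ i * R0 v"
      unfolding *(5)[rule_format] by (simp add: algebra_simps)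
    ultimately show ?thesis by blast
  next
    case True
    \<comment> \<open>The term \<open>v $ 2 * R1 v\<close> acquires a square of the second
      coordinate, which is traded for the quadratic form plus \<open>v $ 1 * v $ 3\<close>. Hence
      \<open>R1\<close> joins the quotient, \<open>R0\<close> becomes the linear coefficient, and
      \<open>v $ 1 * (v $ 3 * R1 v)\<close> the constant one.\<close>
    have "hp (int (Suc n) - 2) (\<lambda>v. v $ 2 * P v + R1 v)"
      using hp_add[OF hp_coord[OF *(1), of 2], of R1] *(2) by (simp add: algebra_simps)
    moreover have "hp (int n - 1 + 1 + 1) (\<lambda>v. v $ 1 * (v $ 3 * R1 v))"
      using *(2) by (intro hp_coord)
    then have "hp (int (Suc n)) (\<lambda>v. v $ 1 * (v $ 3 * R1 v))" by (simp add: algebra_simps)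
    moreover have "\<forall>v w. v $ 1 = w $ 1 \<longrightarrow> v $ 3 = w $ 3 \<longrightarrow>
        R0 v = R0 w \<and> v $ 1 * (v $ 3 * R1 v) = w $ 1 * (w $ 3 * R1 w)"
      using *(4) by metis
    moreover have "\<forall>v. v $ i * f v = ((v $ 2)\<^sup>2 - v $ 1 * v $ 3) * (v $ 2 * P v + R1 v) +
        v $ 2 * R0 v + v $ 1 * (v $ 3 * R1 v)"
      unfolding *(5)[rule_format] True by (simp add: algebra_simps power2_eq_square)
    moreover have "hp (int (Suc n) - 1) R0" using *(3) by simp
    ultimately show ?thesis by blast
  qed
qed

text \<open>The remainder is linear in the second coordinate. Over nonzero outer coordinates the
  conic has two points, with second coordinates \<open>s\<close> and \<open>- s\<close>; vanishing
  at both kills \<open>R1\<close> and \<open>R0\<close> there, and cancelling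
  \<open>v $ 1 * v $ 3\<close> kills them everywhere.\<close>

lemma hp_standard_conic_dvd:
  assumes "hp d f" "\<And>u. f (vector [1, u, u\<^sup>2]) = 0"
  shows "\<exists>P. hp (d - 2) P \<and> (\<forall>v. f v = ((v $ 2)\<^sup>2 - v $ 1 * v $ 3) * P v)"
proof (cases "d < 0")
  case True
  with assms(1) show ?thesis by (intro exI[of _ "\<lambda>v. 0"]) (auto simp: hp_def hpoly_zero)
next
  case False
  then obtain n where n: "d = int n" by (metis nonneg_int_cases not_less)
  with assms have hf: "hpoly n f" by (auto simp: hp_def)
  then obtain P R1 R0 where *:
    "hp (int n - 2) P" "hp (int n - 1) R1" "hp (int n) R0"
    "\<And>v w. v $ 1 = w $ 1 \<Longrightarrow> v $ 3 = w $ 3 \<Longrightarrow> R1 v = R1 w \<and> R0 v = R0 w"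
    "\<And>v. f v = ((v $ 2)\<^sup>2 - v $ 1 * v $ 3) * P v + v $ 2 * R1 v + R0 v"
    using hpoly_standard_conic_remainder by metis
  have f0: "f w = 0" if "(w $ 2)\<^sup>2 = w $ 1 * w $ 3" "w $ 1 \<noteq> 0" for w
  proof -
    have "w = w $ 1 *s vector [1, w $ 2 / w $ 1, (w $ 2 / w $ 1)\<^sup>2]"
      using that by (simp add: vec_eq_iff forall_3 power2_eq_square field_simps)
    then show ?thesis using hpoly_scale[OF hf] assms(2) by (metis mult_zero_right)
  qed
  have R: "R1 v = 0 \<and> R0 v = 0" if v: "v $ 1 \<noteq> 0" "v $ 3 \<noteq> 0" for v
  proof -
    define s where "s = csqrt (v $ 1 * v $ 3)"
    have s: "s\<^sup>2 = v $ 1 * v $ 3" "s \<noteq> 0" using v by (auto simp: s_def)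
    let ?p = "vector [v $ 1, s, v $ 3] :: complex^3"
    let ?m = "vector [v $ 1, - s, v $ 3] :: complex^3"
    have e: "f ?p = 0" "f ?m = 0" using v s by (auto intro!: f0)
    have "R1 ?p = R1 v" "R0 ?p = R0 v" "R1 ?m = R1 v" "R0 ?m = R0 v"
      using *(4)[of ?p v] *(4)[of ?m v] by auto
    then have e': "s * R1 v + R0 v = 0" "- s * R1 v + R0 v = 0"
      using *(5)[of ?p] *(5)[of ?m] e s by auto
    then have "(s * R1 v + R0 v) + (- s * R1 v + R0 v) = 0" by simp
    then have "R0 v = 0" by simp
    then show ?thesis using e' s by simp
  qed
  have zero: "F v = 0" if F: "hp e F" "\<And>v. v $ 1 \<noteq> 0 \<Longrightarrow> v $ 3 \<noteq> 0 \<Longrightarrow> F v = 0" for e F v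
  proof -
    obtain m where "hpoly m F" using hp_imp_hpoly F(1) by blast
    from hpoly_mult_eq_zeroD[OF hpoly_mult[OF hpoly_nth[of 1] hpoly_nth[of 3]] this, of "vector [1,1,1]"]
    show ?thesis using F(2) by force
  qed
  have "R1 v = 0" "R0 v = 0" for v using zero[of _ R1] zero[of _ R0] R *(2,3) by blast+
  then show ?thesis using *(1,5) n by auto
qed

section \<open>Smooth conics and their parametrisations\<close>

definition dot :: "complex^3 \<Rightarrow> complex^3 \<Rightarrow> complex" where
  "dot v w = v $ 1 * w $ 1 + v $ 2 * w $ 2 + v $ 3 * w $ 3"

lemma dot_add_right: "dot v (w + x) = dot v w + dot v x"
  and dot_scale_right: "dot v (c *s w) = c * dot v w"
  and dot_scale_left: "dot (c *s v) w = c * dot v w"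
  by (simp_all add: dot_def algebra_simps)

lemma dot_eq_zeroD: "(\<And>w. dot v w = 0) \<Longrightarrow> v = 0"
  using dot_def[of v "axis 1 1"] dot_def[of v "axis 2 1"] dot_def[of v "axis 3 1"]
  by (auto simp: vec_eq_iff forall_3 axis_def)

lemma vec3_expand: "(v :: complex^3) = v $ 1 *s axis 1 1 + v $ 2 *s axis 2 1 + v $ 3 *s axis 3 (1::complex)"
  by (simp add: vec_eq_iff forall_3 axis_def)

text \<open>The point \<open>D\<close> sits at parameter infinity and is the one point of the conic
  that the parametrisation omits; \<open>conic_tangent\<close> is the derivative in
  \<open>u\<close>.\<close>

definition conic_point :: "complex^3 \<Rightarrow> complex^3 \<Rightarrow> complex^3 \<Rightarrow> complex \<Rightarrow> complex^3" where
  "conic_point A B D u = A + u *s B + u\<^sup>2 *s D"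

definition conic_tangent :: "complex^3 \<Rightarrow> complex^3 \<Rightarrow> complex \<Rightarrow> complex^3" where
  "conic_tangent B D u = B + (2 * u) *s D"

lemma hpoly_conic_point:
  assumes "hpoly n f"
  shows "\<exists>p. degree p \<le> 2 * n \<and> (\<forall>u. f (conic_point A B D u) = poly p u)"
proof -
  have "\<exists>p. degree p \<le> 2 \<and> (\<forall>u. conic_point A B D u $ i = poly p u)" for i
    by (rule exI[of _ "[:A $ i, B $ i, D $ i:]"])
       (auto simp: conic_point_def algebra_simps power2_eq_square)
  from hpoly_curve[OF assms this] show ?thesis by (simp add: mult.commute)
qed

section \<open>Symmetric bilinear forms and bases adapted to a conic\<close>

locale symmetric_bilinear =
  fixes b :: "complex^3 \<Rightarrow> complex^3 \<Rightarrow> complex"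
  assumes sym: "b v w = b w v"
    and add_left: "b (v + w) x = b v x + b w x"
    and scale_left: "b (c *s v) w = c * b v w"
begin

lemma add_right: "b x (v + w) = b x v + b x w"
  using add_left sym by metis

lemma scale_right: "b w (c *s v) = c * b w v"
  using scale_left sym by metis

lemmas bilin = add_left add_right scale_left scale_right

lemma zero_left [simp]: "b 0 w = 0"
  using scale_left[of 0 0 w] by simp

lemma expand: "b v w = (\<Sum>i\<in>UNIV. \<Sum>j\<in>UNIV. b (axis i 1) (axis j 1) * (v $ i * w $ j))"
proof -
  have "b v w = b (v $ 1 *s axis 1 1 + v $ 2 *s axis 2 1 + v $ 3 *s axis 3 1)
      (w $ 1 *s axis 1 1 + w $ 2 *s axis 2 1 + w $ 3 *s axis 3 1)"
    by (rule arg_cong2[where f = b, OF vec3_expand vec3_expand])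
  also have "\<dots> = (\<Sum>i\<in>UNIV. \<Sum>j\<in>UNIV. b (axis i 1) (axis j 1) * (v $ i * w $ j))"
    by (simp add: bilin sum_3 algebra_simps)
  finally show ?thesis .
qed

lemma hpoly_form: "hpoly 2 (\<lambda>v. b v v)"
proof -
  have "hpoly (1 + 1) (\<lambda>v. \<Sum>i\<in>UNIV. \<Sum>j\<in>UNIV. b (axis i 1) (axis j 1) * (v $ i * v $ j))"
    by (intro hpoly_sum hpoly_cmult hpoly_mult hpoly_nth)
  then show ?thesis by (subst expand) (simp add: numeral_2_eq_2)
qed

text \<open>The Gram matrix of the form y^2 - x z in the basis \<open>A\<close>, \<open>B\<close>,
  \<open>D\<close>; the value - 1 / 2 is half the coefficient of x z. In such a basis every smooth
  conic becomes the standard one.\<close>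

definition frame :: "complex^3 \<Rightarrow> complex^3 \<Rightarrow> complex^3 \<Rightarrow> bool" where
  "frame A B D \<longleftrightarrow> b A A = 0 \<and> b A B = 0 \<and> b B D = 0 \<and> b D D = 0 \<and> b B B = 1 \<and> b A D = - 1 / 2"

lemma frame_matrix:
  assumes "\<And>x y z. x *s A + y *s B + z *s D = 0 \<Longrightarrow> x = 0 \<and> y = 0 \<and> z = 0"
  shows "\<exists>M N :: complex^3^3. (\<forall>x. M *v x = x $ 1 *s A + x $ 2 *s B + x $ 3 *s D) \<and> (\<forall>v. M *v (N *v v) = v)"
proof -
  define M :: "complex^3^3" where
    "M = (\<chi> i j. if j = 1 then A $ i else if j = 2 then B $ i else D $ i)"
  have M: "M *v x = x $ 1 *s A + x $ 2 *s B + x $ 3 *s D" for x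
    by (simp add: M_def matrix_vector_mult_def sum_3 vec_eq_iff algebra_simps)
  have "\<forall>x. M *v x = 0 \<longrightarrow> x = 0"
  proof (intro allI impI)
    fix x assume "M *v x = 0"
    then have "x $ 1 *s A + x $ 2 *s B + x $ 3 *s D = 0" by (simp only: M)
    from assms[OF this] show "x = 0" by (simp add: vec_eq_iff forall_3)
  qed
  then obtain N where "N ** M = mat 1" using matrix_left_invertible_ker by blast
  then have "M ** N = mat 1" by (simp add: matrix_left_right_inverse)
  then have "M *v (N *v v) = v" for v by (simp add: matrix_vector_mul_assoc)
  with M show ?thesis by blast
qed

lemma frame_independent:
  assumes "frame A B D" "x *s A + y *s B + z *s D = 0"
  shows "x = 0 \<and> y = 0 \<and> z = 0"
proof -
  have "b (x *s A + y *s B + z *s D) D = 0" "b (x *s A + y *s B + z *s D) B = 0"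
    "b (x *s A + y *s B + z *s D) A = 0" using assms(2) by auto
  then show ?thesis using assms(1) sym[of B A] sym[of D A] sym[of D B] by (simp add: bilin frame_def)
qed

lemma frame_span:
  assumes "frame A B D"
  obtains x y z where "v = x *s A + y *s B + z *s D"
proof -
  obtain M N :: "complex^3^3" where "\<And>x. M *v x = x $ 1 *s A + x $ 2 *s B + x $ 3 *s D" "\<And>v. M *v (N *v v) = v"
    using frame_matrix[OF frame_independent[OF assms]] by blast
  then show ?thesis using that by metis
qed

lemma frame_form:
  assumes "frame A B D"
  shows "b (x *s A + y *s B + z *s D) (x *s A + y *s B + z *s D) = y\<^sup>2 - x * z"
  using assms sym[of B A] sym[of D A] sym[of D B]
  by (simp add: bilin frame_def algebra_simps power2_eq_square)

lemma form_conic_point: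
  assumes "frame A B D"
  shows "b (conic_point A B D u) (conic_point A B D u) = 0"
  using frame_form[OF assms, of 1 u "u\<^sup>2"] by (simp add: conic_point_def)

text \<open>A zero of y^2 - x z with x = 0 also has y = 0 and is a multiple of \<open>D\<close>;
  otherwise its parameter is y / x.\<close>

lemma conic_point_surj:
  assumes "frame A B D" "b p p = 0" "\<And>s. p \<noteq> s *s D"
  obtains s u where "s \<noteq> 0" "p = s *s conic_point A B D u"
proof -
  obtain x y z where p: "p = x *s A + y *s B + z *s D" using frame_span[OF assms(1)] by blast
  have e: "y\<^sup>2 = x * z" using assms(2) frame_form[OF assms(1)] p by simp
  have "x \<noteq> 0"
  proof
    assume "x = 0"
    with e have "y = 0" by simp
    with \<open>x = 0\<close> p assms(3)[of z] show False by simp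
  qed
  moreover have "p = x *s conic_point A B D (y / x)"
    unfolding p conic_point_def using \<open>x \<noteq> 0\<close> e
    by (simp add: vec_eq_iff field_simps power2_eq_square)
  ultimately show ?thesis using that by blast
qed

lemma conic_point_ne_zero:
  assumes "frame A B D"
  shows "conic_point A B D u \<noteq> 0"
  using frame_independent[OF assms, of 1 u "u\<^sup>2"] by (auto simp: conic_point_def)

lemma form_conic_tangent:
  assumes "frame A B D"
  shows "b (conic_point A B D u) (conic_tangent B D u) = 0"
  using assms sym[of D B] by (simp add: conic_point_def conic_tangent_def bilin frame_def)

text \<open>\<open>b p\<close> is, up to a factor, the gradient at \<open>p\<close>, so a covector vanishing on the tangent line is a multiple of it.\<close>

lemma covector_at_conic_point:
  assumes "frame A B D" "dot W (conic_point A B D u) = 0" "dot W (conic_tangent B D u) = 0"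
  shows "dot W w = -2 * dot W D * b (conic_point A B D u) w"
    and "dot W A = u\<^sup>2 * dot W D"
proof -
  have 1: "dot W B = - 2 * u * dot W D" using assms(3)
    by (simp add: conic_tangent_def dot_add_right dot_scale_right eq_neg_iff_add_eq_0)
  show 2: "dot W A = u\<^sup>2 * dot W D" using assms(2) 1
    by (simp add: conic_point_def dot_add_right dot_scale_right power2_eq_square)
  obtain x y z where w: "w = x *s A + y *s B + z *s D" using frame_span[OF assms(1)] by blast
  show "dot W w = -2 * dot W D * b (conic_point A B D u) w"
    unfolding w using assms(1) sym[of B A] sym[of D A] sym[of D B] 1 2
    by (simp add: conic_point_def dot_add_right dot_scale_right bilin frame_def algebra_simps)
qed

lemma hp_conic_dvd:
  assumes fr: "frame A B D" and f: "hp d f" "\<And>u. f (conic_point A B D u) = 0"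
  shows "\<exists>P. hp (d - 2) P \<and> (\<forall>v. f v = b v v * P v)"
proof -
  obtain M N :: "complex^3^3" where M: "\<And>x. M *v x = x $ 1 *s A + x $ 2 *s B + x $ 3 *s D"
    and N: "\<And>v. M *v (N *v v) = v"
    using frame_matrix[OF frame_independent[OF fr]] by blast
  have "f (M *v vector [1, u, u\<^sup>2]) = 0" for u
    using f(2)[of u] by (simp add: M conic_point_def)
  from hp_standard_conic_dvd[OF hp_linear_subst[OF f(1)] this]
  obtain P where P: "hp (d - 2) P" "\<And>v. f (M *v v) = ((v $ 2)\<^sup>2 - v $ 1 * v $ 3) * P v" by blast
  have "f v = b v v * P (N *v v)" for v
    using P(2)[of "N *v v"] frame_form[OF fr] N[of v] M[of "N *v v"] by metis
  then show ?thesis using hp_linear_subst[OF P(1)] by blast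
qed

text \<open>The restriction to the conic of a covector field of degree \<open>m + 1\<close> that is tangent to it is a
  section of a line bundle of degree \<open>2 m\<close>.\<close>

lemma tangent_field_vanishes:
  assumes fr: "frame A B D" and W: "\<And>l. hpoly (Suc m) (\<lambda>v. W v $ l)"
    and euler: "\<And>v. dot (W v) v = 0"
    and tangent: "\<And>u. dot (W (conic_point A B D u)) (conic_tangent B D u) = 0"
    and Z: "finite Z" "card Z > 2 * m" "\<And>u. u \<in> Z \<Longrightarrow> dot (W (conic_point A B D u)) D = 0"
  shows "W (conic_point A B D u) = 0"
proof -
  have hpW: "hpoly (Suc m) (\<lambda>v. dot (W v) w)" for w
  proof -
    have "hpoly (Suc m) (\<lambda>v. w $ 1 * W v $ 1 + w $ 2 * W v $ 2 + w $ 3 * W v $ 3)"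
      by (intro hpoly_add hpoly_cmult W)
    then show ?thesis by (simp add: dot_def mult.commute)
  qed
  obtain pA where pA: "degree pA \<le> 2 * Suc m" "\<And>u. dot (W (conic_point A B D u)) A = poly pA u"
    using hpoly_conic_point[OF hpW] by blast
  obtain pD where pD: "\<And>u. dot (W (conic_point A B D u)) D = poly pD u"
    using hpoly_conic_point[OF hpW] by blast
  have cov: "dot (W (conic_point A B D u)) w = -2 * poly pD u * b (conic_point A B D u) w"
    for u w
    using covector_at_conic_point(1)[OF fr euler tangent, of u w] unfolding pD .
  have cov': "poly pA u = u\<^sup>2 * poly pD u" for u
    using covector_at_conic_point(2)[OF fr euler tangent, of u] unfolding pD pA(2) .
  \<comment> \<open>This identity gains two degrees: \<open>pA\<close> has degree at most
    \<open>2 * Suc m\<close>, hence \<open>pD\<close> at most \<open>2 * m\<close>, while the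
    components of \<open>W\<close> alone would only give \<open>2 * m + 2\<close>.\<close>
  have "poly pA = poly (monom 1 2 * pD)" using cov' by (simp add: fun_eq_iff poly_monom)
  then have eq: "pA = monom 1 2 * pD" by (simp only: poly_eq_poly_eq_iff)
  have "pD = 0"
  proof (rule ccontr)
    assume "pD \<noteq> 0"
    then have "degree pA = 2 + degree pD" unfolding eq by (simp add: degree_mult_eq degree_monom_eq monom_eq_0_iff)
    then have "degree pD \<le> 2 * m" using pA(1) by simp
    moreover have "card Z \<le> card {u. poly pD u = 0}"
      using Z pD poly_roots_finite[OF \<open>pD \<noteq> 0\<close>] by (intro card_mono) auto
    moreover have "card {u. poly pD u = 0} \<le> degree pD"
      using card_poly_roots_bound[OF \<open>pD \<noteq> 0\<close>] .
    ultimately show False using Z(2) by linarith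
  qed
  then show ?thesis using cov by (intro dot_eq_zeroD) simp
qed

end

locale nondegenerate = symmetric_bilinear +
  assumes nondeg: "v \<noteq> 0 \<Longrightarrow> \<exists>w. b v w \<noteq> 0"
begin

text \<open>A line always meets the conic: either \<open>g\<close> is isotropic, or the form is a
  genuinely quadratic polynomial in \<open>u\<close> along \<open>e + u *s g\<close>.\<close>

lemma isotropic_exists: "\<exists>D. D \<noteq> 0 \<and> b D D = 0"
proof -
  define e :: "complex^3" where "e = axis 1 1"
  define g :: "complex^3" where "g = axis 2 1"
  have ne: "g \<noteq> 0" "e + u *s g \<noteq> 0" for u
  proof -
    have "g $ 2 = 1" "(e + u *s g) $ 1 = 1" by (simp_all add: e_def g_def axis_def)
    then show "g \<noteq> 0" "e + u *s g \<noteq> 0" by (metis zero_index zero_neq_one)+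
  qed
  show ?thesis
  proof (cases "b g g = 0")
    case True
    with ne show ?thesis by blast
  next
    case False
    have "\<not> constant (poly [:b e e, 2 * b e g, b g g:])"
      using False by (subst constant_degree) simp
    then obtain u where "poly [:b e e, 2 * b e g, b g g:] u = 0"
      using fundamental_theorem_of_algebra by blast
    then have "b (e + u *s g) (e + u *s g) = 0"
      using sym[of g e] by (simp add: bilin algebra_simps)
    with ne show ?thesis by blast
  qed
qed

lemma frame_exists:
  assumes "D \<noteq> 0" "b D D = 0"
  obtains A B where "frame A B D"
proof -
  obtain x where x: "b D x \<noteq> 0" using nondeg assms(1) by blast
  \<comment> \<open>The constant \<open>c\<close> makes \<open>A0\<close> isotropic, and
    \<open>e\<close> scales its product with \<open>D\<close> to - 1 / 2.\<close>
  define c where "c = - b x x / (2 * b D x)"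
  define A0 where "A0 = x + c *s D"
  define e where "e = - 1 / (2 * b D x)"
  define A where "A = e *s A0"
  have A0: "b A0 A0 = 0" "b A0 D = b D x" using x assms(2) sym[of x D]
    by (simp_all add: A0_def bilin) (simp add: c_def field_simps)
  have A: "b A A = 0" "b A D = - 1 / 2" using x by (simp_all add: A_def scale_left scale_right A0) (simp add: e_def)
  \<comment> \<open>The orthogonal projection away from the span of \<open>A\<close> and
    \<open>D\<close>; the factors 2 compensate \<open>b A D = - 1 / 2\<close>.\<close>
  define B0 where "B0 = (\<lambda>y. y + (2 * b y D) *s A + (2 * b y A) *s D)"
  have B0: "b (B0 y) A = 0" "b (B0 y) D = 0" for y
    using A sym[of D A] assms(2) by (simp_all add: B0_def bilin)
  have "\<exists>y. B0 y \<noteq> 0"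
  proof (rule ccontr)
    assume "\<not> ?thesis"
    then have B00: "B0 y = 0" for y by blast
    \<comment> \<open>The cross product of \<open>A\<close> and \<open>D\<close>. If the projection
      were zero, every vector would lie in the span of \<open>A\<close> and \<open>D\<close>, so
      this covector would vanish and \<open>A\<close> would be a multiple of the isotropic
      \<open>D\<close>.\<close>
    let ?w = "vector [A $ 2 * D $ 3 - A $ 3 * D $ 2, A $ 3 * D $ 1 - A $ 1 * D $ 3, A $ 1 * D $ 2 - A $ 2 * D $ 1] :: complex^3"
    have d: "dot ?w A = 0" "dot ?w D = 0" by (simp_all add: dot_def algebra_simps)
    have "dot ?w y = 0" for y
    proof -
      have "dot ?w (B0 y) = 0" using B00 by (simp add: dot_def)
      then show ?thesis using d by (simp add: B0_def dot_add_right dot_scale_right)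
    qed
    then have "?w = 0" by (rule dot_eq_zeroD)
    then have w: "A $ 2 * D $ 3 = A $ 3 * D $ 2" "A $ 3 * D $ 1 = A $ 1 * D $ 3" "A $ 1 * D $ 2 = A $ 2 * D $ 1"
      by (auto simp: vec_eq_iff forall_3)
    obtain i where i: "D $ i \<noteq> 0" using assms(1) by (auto simp: vec_eq_iff)
    have "i = 1 \<or> i = 2 \<or> i = 3" using exhaust_3 by blast
    then have "A = (A $ i / D $ i) *s D"
      using i w by (auto simp: vec_eq_iff forall_3 field_simps)
    then have "b A D = A $ i / D $ i * b D D" by (metis scale_left)
    with A assms(2) show False by simp
  qed
  then obtain y where y: "B0 y \<noteq> 0" by blast
  define B1 where "B1 = B0 y"
  have B1: "b B1 A = 0" "b B1 D = 0" "B1 \<noteq> 0" using B0 y by (simp_all add: B1_def)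
  \<comment> \<open>An isotropic \<open>B1\<close> would be orthogonal to the whole basis
    \<open>A\<close>, \<open>B1\<close>, \<open>D\<close>, against nondegeneracy.\<close>
  have "b B1 B1 \<noteq> 0"
  proof
    assume iso: "b B1 B1 = 0"
    have ind: "s = 0 \<and> t = 0 \<and> u = 0" if z: "s *s A + t *s B1 + u *s D = 0" for s t u
    proof -
      have "b (s *s A + t *s B1 + u *s D) D = 0" "b (s *s A + t *s B1 + u *s D) A = 0" using z by auto
      then have su: "s = 0" "u = 0" using A B1 assms(2) sym[of D A] by (simp_all add: bilin)
      with z have "t *s B1 = 0" by simp
      with B1(3) su show ?thesis by (auto simp: vec_eq_iff)
    qed
    have "b B1 w = 0" for w
    proof -
      obtain M N :: "complex^3^3" where "\<And>x. M *v x = x $ 1 *s A + x $ 2 *s B1 + x $ 3 *s D" "\<And>v. M *v (N *v v) = v"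
        using frame_matrix[of A B1 D] ind by blast
      then obtain s t u where "w = s *s A + t *s B1 + u *s D" by metis
      then show ?thesis using iso B1 by (simp add: bilin)
    qed
    then show False using nondeg[OF B1(3)] by blast
  qed
  define B where "B = (1 / csqrt (b B1 B1)) *s B1"
  have "b B B = 1" using \<open>b B1 B1 \<noteq> 0\<close>
    by (simp add: B_def scale_left scale_right field_simps flip: power2_eq_square)
  moreover have "b A B = 0" "b B D = 0" using B1 sym[of A B1] by (simp_all add: B_def scale_left scale_right)
  ultimately have "frame A B D" using A assms(2) by (simp add: frame_def)
  then show ?thesis using that by blast
qed

end

section \<open>Covector fields tangent to an arrangement of conics\<close>

lemma poly_eq_0_cofinite:
  fixes p :: "complex poly"
  assumes "finite S" "\<And>u. u \<notin> S \<Longrightarrow> poly p u = 0"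
  shows "p = 0"
proof (rule ccontr)
  assume "p \<noteq> 0"
  then have "finite (S \<union> {u. poly p u = 0})" using assms(1) poly_roots_finite by blast
  moreover have "S \<union> {u. poly p u = 0} = UNIV" using assms(2) by blast
  ultimately show False using infinite_UNIV_char_0[where 'a = complex] by simp
qed

lemma card_roots_rsquarefree:
  fixes p :: "complex poly"
  assumes "rsquarefree p"
  shows "card {z. poly p z = 0} = degree p"
proof -
  have "p \<noteq> 0" using assms by (simp add: rsquarefree_def)
  have "degree p = degree (smult (lead_coeff p) (\<Prod>z | poly p z = 0. [:-z, 1:]))"
    by (simp only: complex_poly_decompose_rsquarefree[OF assms])
  also have "\<dots> = degree (\<Prod>z | poly p z = 0. [:-z, 1:])" using \<open>p \<noteq> 0\<close> by simp
  also have "\<dots> = card {z. poly p z = 0}"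
    by (subst degree_prod_eq_sum_degree) auto
  finally show ?thesis by simp
qed

lemma dot_conic_tangent_poly:
  assumes "\<And>l. \<exists>n. hpoly n (\<lambda>v. W v $ l)"
  shows "\<exists>p. \<forall>u. dot (W (conic_point A B D u)) (conic_tangent B D u) = poly p u"
proof -
  have "\<exists>p. \<forall>u. W (conic_point A B D u) $ l = poly p u" for l
    using assms hpoly_conic_point by metis
  then obtain p where p: "\<And>l u. W (conic_point A B D u) $ l = poly (p l) u" by metis
  show ?thesis
    by (rule exI[of _ "\<Sum>l\<in>UNIV. p l * [:B $ l, 2 * D $ l:]"])
       (simp add: dot_def p sum_3 conic_tangent_def algebra_simps)
qed

context symmetric_bilinear
begin

lemma covector_form: "\<exists>W. \<forall>w. dot W w = b v w"
proof -
  have "dot (\<chi> i. b v (axis i 1)) w = b v w" for w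
  proof -
    have "b v w = b v (w $ 1 *s axis 1 1 + w $ 2 *s axis 2 1 + w $ 3 *s axis 3 1)"
      by (rule arg_cong[OF vec3_expand])
    then show ?thesis by (simp add: dot_def add_right scale_right)
  qed
  then show ?thesis by blast
qed

text \<open>The pullback of the form to a parametrised conic. Its roots are the parameters of the
  intersection points, and its leading coefficient in degree 4 is nonzero when the point at infinity
  is off the second conic.\<close>

definition conic_poly :: "complex^3 \<Rightarrow> complex^3 \<Rightarrow> complex^3 \<Rightarrow> complex poly" where
  "conic_poly A B D = [:b A A, 2 * b A B, b B B + 2 * b A D, 2 * b B D, b D D:]"

lemma poly_conic_poly:
  "poly (conic_poly A B D) u = b (conic_point A B D u) (conic_point A B D u)"
  using sym[of B A] sym[of D A] sym[of D B]
  by (simp add: conic_poly_def conic_point_def bilin algebra_simps power2_eq_square)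

lemma poly_pderiv_conic_poly:
  "poly (pderiv (conic_poly A B D)) u = 2 * b (conic_point A B D u) (conic_tangent B D u)"
  using sym[of B A] sym[of D A] sym[of D B]
  by (simp add: conic_poly_def conic_point_def conic_tangent_def bilin algebra_simps
      power2_eq_square pderiv_pCons)

lemma degree_conic_poly: "b D D \<noteq> 0 \<Longrightarrow> degree (conic_poly A B D) = 4"
  by (simp add: conic_poly_def)

end

text \<open>Isolates what the count takes from nodes and ordinary triple points. Distinct tangents
  are expressed through gradients: up to the factor 2, \<open>b i p\<close> is the differential at
  \<open>p\<close> of the quadratic form.\<close>

locale conic_arrangement =
  fixes k :: nat and b :: "nat \<Rightarrow> complex^3 \<Rightarrow> complex^3 \<Rightarrow> complex"
  assumes nondegenerate: "i < k \<Longrightarrow> nondegenerate (b i)"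
    and transversal: "\<lbrakk>i < k; j < k; i \<noteq> j; p \<noteq> 0; b i p p = 0; b j p p = 0\<rbrakk>
      \<Longrightarrow> \<not> (\<exists>c. \<forall>w. b i p w = c * b j p w)"
    and multiplicity_le_3: "p \<noteq> 0 \<Longrightarrow> card {j. j < k \<and> b j p p = 0} \<le> 3"
begin

abbreviation "frm i \<equiv> symmetric_bilinear.frame (b i)"

lemma bilinear: "i < k \<Longrightarrow> symmetric_bilinear (b i)"
  using nondegenerate nondegenerate.axioms by blast

text \<open>At a multiple root the covector \<open>b j p\<close> would annihilate both the point and
  the tangent of conic \<open>i\<close>, hence be a multiple of \<open>b i p\<close>. In this way
  transversality makes intersection parameters distinct.\<close>

lemma rsquarefree_conic_poly:
  assumes ij: "i < k" "j < k" "i \<noteq> j" and fr: "frm i A B D"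
  shows "rsquarefree (symmetric_bilinear.conic_poly (b j) A B D)"
proof -
  interpret I: symmetric_bilinear "b i" using bilinear ij by blast
  interpret J: symmetric_bilinear "b j" using bilinear ij by blast
  show ?thesis unfolding rsquarefree_roots
  proof (intro allI notI)
    fix u
    define p where "p = conic_point A B D u"
    assume "poly (J.conic_poly A B D) u = 0 \<and> poly (pderiv (J.conic_poly A B D)) u = 0"
    then have z: "b j p p = 0" "b j p (conic_tangent B D u) = 0"
      by (simp_all add: J.poly_conic_poly J.poly_pderiv_conic_poly p_def)
    obtain W where W: "\<And>w. dot W w = b j p w" using J.covector_form by blast
    have "dot W w = -2 * dot W D * b i p w" for w
      using I.covector_at_conic_point(1)[OF fr, of W u w] W z p_def by simp
    then have "b j p w = (-2 * dot W D) * b i p w" for w by (metis W)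
    then show False
      using transversal[of j i p] ij z I.conic_point_ne_zero[OF fr, of u] I.form_conic_point[OF fr, of u]
      unfolding p_def by blast
  qed
qed

lemma finite_bad:
  assumes "i < k" "frm i A B D"
  shows "finite {u. \<exists>j<k. j \<noteq> i \<and> b j (conic_point A B D u) (conic_point A B D u) = 0}"
proof -
  have "finite {u. b j (conic_point A B D u) (conic_point A B D u) = 0}" if j: "j < k" "j \<noteq> i" for j
  proof -
    interpret J: symmetric_bilinear "b j" using bilinear j by blast
    have "rsquarefree (J.conic_poly A B D)" using rsquarefree_conic_poly assms j by blast
    then have "J.conic_poly A B D \<noteq> 0" by (simp add: rsquarefree_def)
    from poly_roots_finite[OF this] show ?thesis by (simp add: J.poly_conic_poly)
  qed
  then have "finite (\<Union>j\<in>{j. j < k \<and> j \<noteq> i}. {u. b j (conic_point A B D u) (conic_point A B D u) = 0})"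
    by auto
  then show ?thesis by (rule rev_finite_subset) auto
qed

text \<open>The point at infinity is moved to a point of conic \<open>i\<close> off all the others,
  so that no crossing escapes the parametrisation and every intersection polynomial has full degree
  4.\<close>

lemma good_frame_exists:
  assumes "i < k"
  shows "\<exists>A B D. frm i A B D \<and> (\<forall>j<k. j \<noteq> i \<longrightarrow> b j D D \<noteq> 0)"
proof -
  interpret I: nondegenerate "b i" using nondegenerate assms by blast
  obtain D0 where "D0 \<noteq> 0" "b i D0 D0 = 0" using I.isotropic_exists by blast
  then obtain A0 B0 where fr: "I.frame A0 B0 D0" using I.frame_exists by blast
  obtain u where "u \<notin> {u. \<exists>j<k. j \<noteq> i \<and> b j (conic_point A0 B0 D0 u) (conic_point A0 B0 D0 u) = 0}"
    using ex_new_if_finite[OF infinite_UNIV_char_0 finite_bad[OF assms fr]] by blast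
  then have u: "\<forall>j<k. j \<noteq> i \<longrightarrow> b j (conic_point A0 B0 D0 u) (conic_point A0 B0 D0 u) \<noteq> 0" by blast
  obtain A B where "I.frame A B (conic_point A0 B0 D0 u)"
    using I.frame_exists[OF I.conic_point_ne_zero[OF fr] I.form_conic_point[OF fr]] by blast
  with u show ?thesis by blast
qed

end

section \<open>Counting crossings and dividing by one conic after another\<close>

locale framed_arrangement = conic_arrangement +
  fixes A B D :: "nat \<Rightarrow> complex^3"
  assumes frame: "i < k \<Longrightarrow> frm i (A i) (B i) (D i)"
    and D_off: "\<lbrakk>i < k; j < k; j \<noteq> i\<rbrakk> \<Longrightarrow> b j (D i) (D i) \<noteq> 0"
begin

definition pt :: "nat \<Rightarrow> complex \<Rightarrow> complex^3" where
  "pt i u = conic_point (A i) (B i) (D i) u"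

definition tg :: "nat \<Rightarrow> complex \<Rightarrow> complex^3" where
  "tg i u = conic_tangent (B i) (D i) u"

text \<open>Earlier conics are left out because at stage \<open>i\<close> the field is a quotient by
  their forms and is known to be tangent only to the conics from \<open>i\<close> on.\<close>

definition meets :: "nat \<Rightarrow> complex set" where
  "meets i = {u. \<exists>j<k. j > i \<and> b j (pt i u) (pt i u) = 0}"

lemma pt_ne_zero: "i < k \<Longrightarrow> pt i u \<noteq> 0"
  unfolding pt_def using symmetric_bilinear.conic_point_ne_zero[OF bilinear frame] .

lemma pt_on: "i < k \<Longrightarrow> b i (pt i u) (pt i u) = 0"
  unfolding pt_def using symmetric_bilinear.form_conic_point[OF bilinear frame] .

lemma covector_at_pt:
  "\<lbrakk>i < k; dot W (pt i u) = 0; dot W (tg i u) = 0\<rbrakk> \<Longrightarrow> dot W w = -2 * dot W (D i) * b i (pt i u) w"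
  unfolding pt_def tg_def by (rule symmetric_bilinear.covector_at_conic_point(1)[OF bilinear frame])

lemma card_meets_pair:
  assumes "i < k" "j < k" "i \<noteq> j"
  shows "card {u. b j (pt i u) (pt i u) = 0} = 4"
proof -
  interpret J: symmetric_bilinear "b j" using bilinear assms by blast
  have "card {u. poly (J.conic_poly (A i) (B i) (D i)) u = 0} = 4"
    using card_roots_rsquarefree[OF rsquarefree_conic_poly] J.degree_conic_poly assms frame D_off
    by metis
  then show ?thesis by (simp add: J.poly_conic_poly pt_def)
qed

lemma finite_meets: "i < k \<Longrightarrow> finite (meets i)"
  unfolding meets_def pt_def by (rule rev_finite_subset[OF finite_bad[OF _ frame]]) auto

text \<open>Double counting of incidences: each later conic contributes four points, and a point
  lies on at most two later conics since conic \<open>i\<close> itself takes one of the three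
  places.\<close>

lemma card_meets_ge:
  assumes i: "i < k"
  shows "card (meets i) \<ge> 2 * (k - 1 - i)"
proof -
  let ?J = "{i<..<k}" and ?P = "\<lambda>j u. b j (pt i u) (pt i u) = 0"
  have fin: "finite (meets i)" using finite_meets i .
  have "4 * (k - 1 - i) = (\<Sum>j\<in>?J. card {u. ?P j u})"
    using i by (simp add: card_meets_pair)
  also have "\<dots> = (\<Sum>j\<in>?J. card {u \<in> meets i. ?P j u})"
    by (rule sum.cong, simp, rule arg_cong[where f = card]) (auto simp: meets_def)
  also have "\<dots> = (\<Sum>j\<in>?J. \<Sum>u\<in>meets i. if ?P j u then 1 else 0)"
    by (simp add: sum.inter_filter[OF fin, symmetric])
  also have "\<dots> = (\<Sum>u\<in>meets i. \<Sum>j\<in>?J. if ?P j u then 1 else 0)"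
    by (rule sum.swap)
  also have "\<dots> = (\<Sum>u\<in>meets i. card {j \<in> ?J. ?P j u})"
    by (simp add: sum.inter_filter[symmetric])
  also have "\<dots> \<le> (\<Sum>u\<in>meets i. 2)"
  proof (rule sum_mono)
    fix u
    have "insert i {j \<in> ?J. ?P j u} \<subseteq> {j. j < k \<and> ?P j u}" using i pt_on by auto
    then have "card (insert i {j \<in> ?J. ?P j u}) \<le> card {j. j < k \<and> ?P j u}"
      by (intro card_mono) auto
    also have "\<dots> \<le> 3" using multiplicity_le_3 pt_ne_zero i by blast
    finally show "card {j \<in> ?J. ?P j u} \<le> 2" by simp
  qed
  finally show ?thesis by simp
qed

text \<open>With a single later conic no two crossings can be shared, so the count is twice the
  general bound 2. This is the source of the saving of two.\<close>

lemma card_meets_last: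
  assumes "Suc (Suc i) = k"
  shows "card (meets i) \<ge> 4"
proof -
  have "{u. b (Suc i) (pt i u) (pt i u) = 0} \<subseteq> meets i" using assms by (auto simp: meets_def)
  from card_mono[OF finite_meets this] show ?thesis using card_meets_pair[of i "Suc i"] assms by simp
qed

text \<open>The zeros still missing from the required \<open>4 * (k - 1 - i) + 1\<close> after the
  guaranteed crossings. On the last but one conic five are required and four are present.\<close>

definition extra :: "nat \<Rightarrow> nat" where
  "extra i = (if Suc (Suc i) = k then 1 else 2 * (k - 1 - i) + 1)"

lemma sum_extra:
  assumes "k \<ge> 2"
  shows "(\<Sum>i<k. extra i) = k\<^sup>2 - 2"
proof -
  have "(\<Sum>i<k. extra i + (if i = k - 2 then 2 else 0)) = (\<Sum>i<k. 2 * (k - 1 - i) + 1)"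
    using assms by (intro sum.cong) (auto simp: extra_def)
  also have "\<dots> = (\<Sum>i<k. 2 * i + 1)"
    by (rule sum.reindex_bij_witness[of _ "\<lambda>i. k - 1 - i" "\<lambda>i. k - 1 - i"]) auto
  also have "\<dots> = k\<^sup>2"
    by (induction k) (auto simp: power2_eq_square)
  finally show ?thesis using assms by (simp add: sum.distrib)
qed

text \<open>At a crossing, tangency to both conics makes \<open>W p\<close> a multiple of two
  gradients, and these are not proportional.\<close>

lemma meets_imp_zero:
  assumes i: "i < k" and u: "u \<in> meets i"
    and W: "\<And>l. hpoly n (\<lambda>v. W v $ l)" and euler: "\<And>v. dot (W v) v = 0"
    and tangent: "\<And>j u. i \<le> j \<Longrightarrow> j < k \<Longrightarrow> dot (W (pt j u)) (tg j u) = 0"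
  shows "dot (W (pt i u)) (D i) = 0"
proof (rule ccontr)
  define p where "p = pt i u"
  assume ne: "dot (W (pt i u)) (D i) \<noteq> 0"
  obtain j where j: "j < k" "j > i" "b j p p = 0" using u by (auto simp: meets_def p_def)
  interpret I: symmetric_bilinear "b i" using bilinear i by blast
  interpret J: symmetric_bilinear "b j" using bilinear j by blast
  \<comment> \<open>The only point without a parameter on conic \<open>j\<close> is
    \<open>D j\<close>, and it lies on no other conic, so the crossing can be described on conic
    \<open>j\<close> as well.\<close>
  have "p \<noteq> s *s D j" for s
  proof
    assume p: "p = s *s D j"
    have "b i p p = 0" using pt_on i by (simp add: p_def)
    then have "s = 0" using D_off[of j i] i j by (simp add: p I.scale_left I.scale_right)
    then show False using p pt_ne_zero[OF i, of u] by (simp add: p_def)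
  qed
  then obtain s u' where s: "s \<noteq> 0" "p = s *s pt j u'"
    using J.conic_point_surj[OF frame[OF j(1)] j(3)] unfolding pt_def by blast
  define c where "c = -2 * dot (W (pt i u)) (D i)"
  define c' where "c' = -2 * dot (W (pt j u')) (D j)"
  have 1: "dot (W p) w = c * b i p w" for w
    unfolding p_def c_def using i by (intro covector_at_pt euler tangent) auto
  have 2: "dot (W (pt j u')) w = c' * b j (pt j u') w" for w
    unfolding c'_def using j by (intro covector_at_pt euler tangent) auto
  \<comment> \<open>The two parametrisations give different representatives of the same projective
    point; homogeneity of \<open>W\<close> relates its values there.\<close>
  have "W p = s ^ n *s W (pt j u')"
    using hpoly_scale[OF W] by (simp add: s(2) vec_eq_iff)
  then have e: "c * b i p w = s ^ n * c' / s * b j p w" for w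
    using 1[of w] 2[of w] s by (simp add: dot_scale_left J.scale_left)
  have "c \<noteq> 0" using ne by (simp add: c_def)
  then have "b i p w = s ^ n * c' / s / c * b j p w" for w
    using e[of w] by (metis nonzero_mult_div_cancel_left times_divide_eq_left)
  moreover have "p \<noteq> 0" "b i p p = 0" using pt_ne_zero i pt_on by (auto simp: p_def)
  ultimately show False using transversal[of i j p] i j by blast
qed

text \<open>The points avoid all other conics so that a zero prescribed there survives division by
  any other form.\<close>

lemma extra_points:
  assumes "i < k"
  shows "\<exists>X. finite X \<and> card X = extra i \<and> (\<forall>u\<in>X. \<forall>j<k. j \<noteq> i \<longrightarrow> b j (pt i u) (pt i u) \<noteq> 0)"
proof -
  let ?bad = "{u. \<exists>j<k. j \<noteq> i \<and> b j (pt i u) (pt i u) = 0}"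
  have "finite ?bad" using finite_bad[OF assms frame[OF assms]] unfolding pt_def .
  then have "infinite (- ?bad)" using infinite_UNIV_char_0[where 'a = complex] finite_compl[of ?bad] by blast
  then obtain X where "finite X" "card X = extra i" "X \<subseteq> - ?bad"
    using infinite_arbitrarily_large by blast
  then show ?thesis by blast
qed

text \<open>Crossings and prescribed points are disjoint and together exceed the number of zeros
  allowed to a nonzero section. For the last conic the quotient has degree - 1, which
  \<open>hp\<close> reads as zero.\<close>

lemma tangent_field_divisible:
  assumes i: "i < k" and W: "\<And>l. hpoly (2 * (k - i) - 1) (\<lambda>v. W v $ l)"
    and euler: "\<And>v. dot (W v) v = 0"
    and tangent: "\<And>j u. i \<le> j \<Longrightarrow> j < k \<Longrightarrow> dot (W (pt j u)) (tg j u) = 0"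
    and X: "finite X" "card X = extra i" "\<And>u. u \<in> X \<Longrightarrow> dot (W (pt i u)) (D i) = 0"
      "\<And>u j. u \<in> X \<Longrightarrow> j < k \<Longrightarrow> j \<noteq> i \<Longrightarrow> b j (pt i u) (pt i u) \<noteq> 0"
  shows "\<exists>W'. (\<forall>l. hp (2 * (int k - int (Suc i)) - 1) (\<lambda>v. W' v $ l)) \<and> (\<forall>v. W v = b i v v *s W' v)"
proof -
  interpret I: symmetric_bilinear "b i" using bilinear i by blast
  let ?m = "2 * (k - 1 - i)"
  have deg: "2 * (k - i) - 1 = Suc ?m" using i by auto
  have "X \<inter> meets i = {}" using X(4) by (fastforce simp: meets_def)
  then have card: "card (meets i \<union> X) = card (meets i) + extra i"
    using X finite_meets[OF i] by (subst card_Un_disjoint) auto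
  have "2 * ?m < card (meets i \<union> X)"
  proof (cases "Suc (Suc i) = k")
    case True
    then have "k - 1 - i = 1" by simp
    then show ?thesis using card_meets_last[OF True] True unfolding card extra_def by simp
  next
    case False
    then show ?thesis using card_meets_ge[OF i] unfolding card extra_def by simp
  qed
  moreover have "dot (W (pt i u)) (D i) = 0" if "u \<in> meets i \<union> X" for u
    using that X(3) meets_imp_zero[OF i _ W euler tangent] by blast
  ultimately have "W (pt i u) = 0" for u
    using I.tangent_field_vanishes[OF frame[OF i] W[unfolded deg] euler tangent[of i, unfolded pt_def tg_def], of "meets i \<union> X" u]
      i finite_meets[OF i] X(1) unfolding pt_def by blast
  then have "W (conic_point (A i) (B i) (D i) u) $ l = 0" for u l
    by (simp add: pt_def)
  from I.hp_conic_dvd[OF frame[OF i] hpoly_imp_hp[OF W refl] this]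
  have "\<exists>P. hp (int (2 * (k - i) - 1) - 2) P \<and> (\<forall>v. W v $ l = b i v v * P v)" for l
    by blast
  then obtain P where P: "\<And>l. hp (int (2 * (k - i) - 1) - 2) (P l)" "\<And>l v. W v $ l = b i v v * P l v"
    by metis
  have "int (2 * (k - i) - 1) - 2 = 2 * (int k - int (Suc i)) - 1" using i by auto
  then have "\<forall>l. hp (2 * (int k - int (Suc i)) - 1) (\<lambda>v. (\<chi> l. P l v) $ l)" using P(1) by simp
  moreover have "\<forall>v. W v = b i v v *s (\<chi> l. P l v)" using P(2) by (simp add: vec_eq_iff)
  ultimately show ?thesis by (intro exI[of _ "\<lambda>v. \<chi> l. P l v"] conjI)
qed

lemma hpoly_dot_self:
  assumes "\<And>l. hp d (\<lambda>v. W v $ l)"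
  shows "\<exists>n. hpoly n (\<lambda>v. dot (W v) v)"
proof -
  have "hp (d + 1) (\<lambda>v. v $ 1 * W v $ 1 + v $ 2 * W v $ 2 + v $ 3 * W v $ 3)"
    by (intro hp_add hp_coord assms)
  then have "hp (d + 1) (\<lambda>v. dot (W v) v)" by (simp add: dot_def mult.commute)
  then show ?thesis by (rule hp_imp_hpoly)
qed

text \<open>The quotient inherits all assumptions: orthogonality to \<open>v\<close> by cancelling a
  nonzero form, tangency because conic \<open>j\<close> meets conic \<open>i\<close> in finitely
  many parameters, and the prescribed zeros because their points are off conic
  \<open>i\<close>.\<close>

lemma tangent_field_eq_zero:
  assumes X: "\<And>i. i < k \<Longrightarrow> finite (X i)" "\<And>i. i < k \<Longrightarrow> card (X i) = extra i"
      "\<And>i u j. i < k \<Longrightarrow> u \<in> X i \<Longrightarrow> j < k \<Longrightarrow> j \<noteq> i \<Longrightarrow> b j (pt i u) (pt i u) \<noteq> 0"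
    and "i \<le> k" and "\<And>l. hp (2 * (int k - int i) - 1) (\<lambda>v. W v $ l)"
    and "\<And>v. dot (W v) v = 0"
    and "\<And>j u. i \<le> j \<Longrightarrow> j < k \<Longrightarrow> dot (W (pt j u)) (tg j u) = 0"
    and "\<And>j u. i \<le> j \<Longrightarrow> j < k \<Longrightarrow> u \<in> X j \<Longrightarrow> dot (W (pt j u)) (D j) = 0"
  shows "W v = 0"
  using assms(4-8)
proof (induction i arbitrary: W v rule: inc_induct)
  case base
  then have "(\<lambda>v. W v $ l) = (\<lambda>v. 0)" for l by (auto simp: hp_def)
  then show ?case by (simp add: vec_eq_iff fun_eq_iff)
next
  case (step i)
  note W = step.prems(1) and euler = step.prems(2) and tangent = step.prems(3) and WX = step.prems(4)
  have i: "i < k" by fact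
  interpret I: symmetric_bilinear "b i" using bilinear i by blast
  have "nat (2 * (int k - int i) - 1) = 2 * (k - i) - 1" using i by simp
  then have "hpoly (2 * (k - i) - 1) (\<lambda>v. W v $ l)" for l
    using W[of l] i by (simp add: hp_def split: if_splits)
  from tangent_field_divisible[OF i this euler tangent X(1,2)[OF i] WX X(3)[OF i]] i
  obtain W' where W': "\<And>l. hp (2 * (int k - int (Suc i)) - 1) (\<lambda>v. W' v $ l)"
    "\<And>v. W v = b i v v *s W' v" by blast
  have dotW: "dot (W v) w = b i v v * dot (W' v) w" for v w by (simp add: W'(2) dot_scale_left)
  have "dot (W' v) v = 0" for v
  proof -
    obtain n where n: "hpoly n (\<lambda>v. dot (W' v) v)" using hpoly_dot_self W'(1) by blast
    have "b i (B i) (B i) \<noteq> 0" using frame[OF i] by (simp add: I.frame_def)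
    from hpoly_mult_eq_zeroD[OF I.hpoly_form n _ this] show ?thesis using dotW euler by metis
  qed
  moreover have "dot (W' (pt j u)) (tg j u) = 0" if j: "Suc i \<le> j" "j < k" for j u
  proof -
    obtain p where p: "\<And>u. dot (W' (pt j u)) (tg j u) = poly p u"
      using dot_conic_tangent_poly[of W'] hp_imp_hpoly[OF W'(1)] unfolding pt_def tg_def by metis
    have "finite {u. \<exists>l<k. l \<noteq> j \<and> b l (pt j u) (pt j u) = 0}"
      using finite_bad[OF j(2) frame[OF j(2)]] unfolding pt_def .
    then have "p = 0"
    proof (rule poly_eq_0_cofinite)
      fix u assume "u \<notin> {u. \<exists>l<k. l \<noteq> j \<and> b l (pt j u) (pt j u) = 0}"
      moreover have "i \<noteq> j" using j by simp
      ultimately have "b i (pt j u) (pt j u) \<noteq> 0" using i by blast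
      then show "poly p u = 0" using tangent[of j u] j dotW p by (metis Suc_leD mult_eq_0_iff)
    qed
    then show ?thesis using p by simp
  qed
  moreover have "dot (W' (pt j u)) (D j) = 0" if j: "Suc i \<le> j" "j < k" "u \<in> X j" for j u
  proof -
    have "b i (pt j u) (pt j u) \<noteq> 0" using X(3)[of j u i] i j by simp
    then show ?thesis using WX[of j u] j dotW by (metis Suc_leD mult_eq_0_iff)
  qed
  ultimately have "W' v = 0" using step.IH[of W' v] W'(1) by blast
  then show ?case by (simp add: W'(2))
qed

end

context conic_arrangement
begin

text \<open>The dimension bound in dual form. Tangency is required only at points on exactly one
  conic, since at a crossing the gradient of the product vanishes and a syzygy yields nothing; the
  finitely many remaining parameters follow by polynomial identity.\<close>

theorem tangent_field_test_set:
  assumes "k \<ge> 2"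
  shows "\<exists>E. finite E \<and> card E \<le> k\<^sup>2 - 2 \<and>
    (\<forall>W. (\<forall>l. hpoly (2 * k - 1) (\<lambda>v. W v $ l)) \<longrightarrow> (\<forall>v. dot (W v) v = 0) \<longrightarrow>
      (\<forall>i<k. \<forall>p. b i p p = 0 \<longrightarrow> (\<forall>j<k. j \<noteq> i \<longrightarrow> b j p p \<noteq> 0) \<longrightarrow>
        (\<exists>c. \<forall>w. dot (W p) w = c * b i p w)) \<longrightarrow>
      (\<forall>(p, w)\<in>E. dot (W p) w = 0) \<longrightarrow> (\<forall>v. W v = 0))"
proof -
  obtain A B D where "\<And>i. i < k \<Longrightarrow> frm i (A i) (B i) (D i)"
    "\<And>i j. i < k \<Longrightarrow> j < k \<Longrightarrow> j \<noteq> i \<Longrightarrow> b j (D i) (D i) \<noteq> 0"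
    using good_frame_exists by metis
  then interpret framed_arrangement k b A B D by unfold_locales
  obtain X where X: "\<And>i. i < k \<Longrightarrow> finite (X i)" "\<And>i. i < k \<Longrightarrow> card (X i) = extra i"
      "\<And>i u j. i < k \<Longrightarrow> u \<in> X i \<Longrightarrow> j < k \<Longrightarrow> j \<noteq> i \<Longrightarrow> b j (pt i u) (pt i u) \<noteq> 0"
    using extra_points by metis
  \<comment> \<open>Pairing with \<open>D i\<close> is enough: at a point of the conic it determines
    the whole tangent covector.\<close>
  define E where "E = (\<lambda>(i, u). (pt i u, D i)) ` (SIGMA i:{..<k}. X i)"
  have fin: "finite (SIGMA i:{..<k}. X i)" using X(1) by auto
  then have "card E \<le> card (SIGMA i:{..<k}. X i)" unfolding E_def by (rule card_image_le)
  also have "\<dots> = (\<Sum>i<k. extra i)" using X(1,2) by (subst card_SigmaI) auto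
  also have "\<dots> = k\<^sup>2 - 2" using sum_extra[OF assms] .
  finally have card: "card E \<le> k\<^sup>2 - 2" .
  have finE: "finite E" unfolding E_def using fin by blast
  have zero: "W v = 0"
    if W: "\<forall>l. hpoly (2 * k - 1) (\<lambda>v. W v $ l)" and euler: "\<forall>v. dot (W v) v = 0"
      and tan: "\<forall>i<k. \<forall>p. b i p p = 0 \<longrightarrow> (\<forall>j<k. j \<noteq> i \<longrightarrow> b j p p \<noteq> 0) \<longrightarrow>
        (\<exists>c. \<forall>w. dot (W p) w = c * b i p w)"
      and WE: "\<forall>(p, w)\<in>E. dot (W p) w = 0" for W v
  proof (rule tangent_field_eq_zero[of X 0 W v])
    show "hp (2 * (int k - int 0) - 1) (\<lambda>v. W v $ l)" for l
      using W assms by (intro hpoly_imp_hp[of "2 * k - 1"]) auto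
    show "dot (W (pt j u)) (tg j u) = 0" if j: "j < k" for j u
    proof -
      interpret J: symmetric_bilinear "b j" using bilinear j by blast
      obtain p where p: "\<And>u. dot (W (pt j u)) (tg j u) = poly p u"
        using dot_conic_tangent_poly[of W] W unfolding pt_def tg_def by metis
      have "finite {u. \<exists>l<k. l \<noteq> j \<and> b l (pt j u) (pt j u) = 0}"
        using finite_bad[OF j frame[OF j]] unfolding pt_def .
      then have "p = 0"
      proof (rule poly_eq_0_cofinite)
        fix u assume "u \<notin> {u. \<exists>l<k. l \<noteq> j \<and> b l (pt j u) (pt j u) = 0}"
        then obtain c where "\<And>w. dot (W (pt j u)) w = c * b j (pt j u) w"
          using tan j pt_on[OF j] by blast
        then show "poly p u = 0"
          using J.form_conic_tangent[OF frame[OF j]] p unfolding pt_def tg_def by (metis mult_zero_right)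
      qed
      then show ?thesis using p by simp
    qed
    show "dot (W (pt j u)) (D j) = 0" if "j < k" "u \<in> X j" for j u
      using WE that by (auto simp: E_def)
  qed (use X euler in auto)
  show ?thesis
    by (intro exI[of _ E] conjI allI impI finE card) (rule zero)
qed

end

section \<open>Taylor expansion and tangent cones\<close>

definition vec3 :: "complex \<Rightarrow> complex \<Rightarrow> complex \<Rightarrow> complex^3" where
  "vec3 x y z = vector [x, y, z]"

lemma vec3_nth [simp]: "vec3 x y z $ 1 = x" "vec3 x y z $ 2 = y" "vec3 x y z $ 3 = z"
  by (simp_all add: vec3_def)

lemma vec3_eta [simp]: "vec3 (v $ 1) (v $ 2) (v $ 3) = v"
  by (simp add: vec_eq_iff forall_3)

definition cpoly :: "nat \<Rightarrow> (nat \<Rightarrow> nat \<Rightarrow> nat \<Rightarrow> complex) \<Rightarrow> pf" where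
  "cpoly N c = (\<lambda>x y z. \<Sum>i\<le>N. \<Sum>j\<le>N. \<Sum>l\<le>N. c i j l * x^i * y^j * z^l)"

text \<open>Differentiation shifts an index and reads the coefficient at \<open>Suc N\<close>, so
  the coefficients have to vanish outside the box.\<close>

definition csupp :: "nat \<Rightarrow> (nat \<Rightarrow> nat \<Rightarrow> nat \<Rightarrow> complex) \<Rightarrow> bool" where
  "csupp N c \<longleftrightarrow> (\<forall>i j l. i > N \<or> j > N \<or> l > N \<longrightarrow> c i j l = 0)"

lemma cpoly_X: "cpoly N c x y z = (\<Sum>i\<le>N. (\<Sum>j\<le>N. \<Sum>l\<le>N. c i j l * y^j * z^l) * x^i)"
  unfolding cpoly_def by (simp add: sum_distrib_left sum_distrib_right mult_ac)

lemma cpoly_Y: "cpoly N c x y z = (\<Sum>j\<le>N. (\<Sum>i\<le>N. \<Sum>l\<le>N. c i j l * x^i * z^l) * y^j)"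
proof -
  have "cpoly N c x y z = (\<Sum>j\<le>N. \<Sum>i\<le>N. \<Sum>l\<le>N. c i j l * x^i * y^j * z^l)"
    unfolding cpoly_def by (rule sum.swap)
  then show ?thesis by (simp add: sum_distrib_left sum_distrib_right mult_ac)
qed

lemma cpoly_Z: "cpoly N c x y z = (\<Sum>l\<le>N. (\<Sum>i\<le>N. \<Sum>j\<le>N. c i j l * x^i * y^j) * z^l)"
proof -
  have "cpoly N c x y z = (\<Sum>i\<le>N. \<Sum>l\<le>N. \<Sum>j\<le>N. c i j l * x^i * y^j * z^l)"
    unfolding cpoly_def by (intro sum.cong refl sum.swap)
  also have "\<dots> = (\<Sum>l\<le>N. \<Sum>i\<le>N. \<Sum>j\<le>N. c i j l * x^i * y^j * z^l)" by (rule sum.swap)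
  finally show ?thesis by (simp add: sum_distrib_right)
qed

lemma deriv_power_sum:
  fixes a :: "nat \<Rightarrow> complex"
  assumes "a (Suc N) = 0"
  shows "deriv (\<lambda>t. \<Sum>i\<le>N. a i * t^i) x = (\<Sum>i\<le>N. of_nat (Suc i) * a (Suc i) * x^i)"
proof -
  have "((\<lambda>t. \<Sum>i\<le>N. a i * t^i) has_field_derivative (\<Sum>i\<le>N. a i * (of_nat i * x^(i - 1)))) (at x)"
    by (auto intro!: derivative_eq_intros sum.cong)
  then have "deriv (\<lambda>t. \<Sum>i\<le>N. a i * t^i) x = (\<Sum>i\<le>N. a i * (of_nat i * x^(i - 1)))"
    by (rule DERIV_imp_deriv)
  also have "\<dots> = (\<Sum>i\<le>Suc N. a i * (of_nat i * x^(i - 1)))" using assms by simp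
  also have "\<dots> = (\<Sum>i\<le>N. a (Suc i) * (of_nat (Suc i) * x^i))"
    by (subst sum.atMost_Suc_shift) simp
  finally show ?thesis by (simp add: mult_ac)
qed

lemma dX_cpoly:
  assumes "csupp N c"
  shows "dX (cpoly N c) = cpoly N (\<lambda>i j l. of_nat (Suc i) * c (Suc i) j l)"
  using assms unfolding dX_def cpoly_X csupp_def
  by (intro ext, subst deriv_power_sum) (simp_all add: sum_distrib_left sum_distrib_right mult_ac)

lemma dY_cpoly:
  assumes "csupp N c"
  shows "dY (cpoly N c) = cpoly N (\<lambda>i j l. of_nat (Suc j) * c i (Suc j) l)"
  using assms unfolding dY_def cpoly_Y csupp_def
  by (intro ext, subst deriv_power_sum) (simp_all add: sum_distrib_left sum_distrib_right mult_ac)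

lemma dZ_cpoly:
  assumes "csupp N c"
  shows "dZ (cpoly N c) = cpoly N (\<lambda>i j l. of_nat (Suc l) * c i j (Suc l))"
  using assms unfolding dZ_def cpoly_Z csupp_def
  by (intro ext, subst deriv_power_sum) (simp_all add: sum_distrib_left sum_distrib_right mult_ac)

lemma dX_power_cpoly:
  assumes "csupp N c"
  shows "(dX ^^ n) (cpoly N c) = cpoly N (\<lambda>i j l. fact (i + n) / fact i * c (i + n) j l)"
proof (induction n)
  case (Suc n)
  have "csupp N (\<lambda>i j l. fact (i + n) / fact i * c (i + n) j l)" using assms by (auto simp: csupp_def)
  from dX_cpoly[OF this] show ?case
    by (simp add: Suc del: of_nat_Suc)
qed simp

lemma dY_power_cpoly:
  assumes "csupp N c"
  shows "(dY ^^ n) (cpoly N c) = cpoly N (\<lambda>i j l. fact (j + n) / fact j * c i (j + n) l)"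
proof (induction n)
  case (Suc n)
  have "csupp N (\<lambda>i j l. fact (j + n) / fact j * c i (j + n) l)" using assms by (auto simp: csupp_def)
  from dY_cpoly[OF this] show ?case
    by (simp add: Suc del: of_nat_Suc)
qed simp

lemma dZ_power_cpoly:
  assumes "csupp N c"
  shows "(dZ ^^ n) (cpoly N c) = cpoly N (\<lambda>i j l. fact (l + n) / fact l * c i j (l + n))"
proof (induction n)
  case (Suc n)
  have "csupp N (\<lambda>i j l. fact (l + n) / fact l * c i j (l + n))" using assms by (auto simp: csupp_def)
  from dZ_cpoly[OF this] show ?case
    by (simp add: Suc del: of_nat_Suc)
qed simp

lemma cpoly_0: "cpoly N c 0 0 0 = c 0 0 0"
proof -
  have *: "(\<Sum>i\<le>N. f i * 0 ^ i) = f 0" for f :: "nat \<Rightarrow> complex"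
    using sum.remove[of "{..N}" 0 "\<lambda>i. f i * 0 ^ i"] by simp
  show ?thesis by (simp add: cpoly_def *)
qed

lemma Dm_cpoly_0:
  assumes "csupp N g"
  shows "Dm a b c (cpoly N g) 0 0 0 = fact a * fact b * fact c * g a b c"
proof -
  let ?g1 = "\<lambda>i j l. fact (l + c) / fact l * g i j (l + c)"
  let ?g2 = "\<lambda>i j l. fact (j + b) / fact j * ?g1 i (j + b) l"
  have s: "csupp N ?g1" "csupp N ?g2" using assms by (auto simp: csupp_def)
  show ?thesis
    unfolding Dm_def dZ_power_cpoly[OF assms] dY_power_cpoly[OF s(1)] dX_power_cpoly[OF s(2)] cpoly_0
    by simp
qed

text \<open>Brings a point to the origin, where iterated partial derivatives read off single
  coefficients.\<close>

definition translate :: "complex \<Rightarrow> complex \<Rightarrow> complex \<Rightarrow> pf \<Rightarrow> pf" where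
  "translate a b c f = (\<lambda>x y z. f (x + a) (y + b) (z + c))"

lemma deriv_translate: "deriv (\<lambda>t. f (t + a)) x = deriv f (x + (a :: complex))"
  unfolding deriv_def by (simp add: DERIV_shift)

lemma Dm_translate: "Dm a b c (translate p q r f) = translate p q r (Dm a b c f)"
proof -
  have 1: "dX (translate p q r f) = translate p q r (dX f)" for f
    by (simp add: dX_def translate_def deriv_translate[of "\<lambda>t. f t _ _"])
  have 2: "dY (translate p q r f) = translate p q r (dY f)" for f
    by (simp add: dY_def translate_def deriv_translate[of "\<lambda>t. f _ t _"])
  have 3: "dZ (translate p q r f) = translate p q r (dZ f)" for f
    by (simp add: dZ_def translate_def deriv_translate[of "\<lambda>t. f _ _ t"])
  have "(dX ^^ n) (translate p q r f) = translate p q r ((dX ^^ n) f)"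
    "(dY ^^ n) (translate p q r f) = translate p q r ((dY ^^ n) f)"
    "(dZ ^^ n) (translate p q r f) = translate p q r ((dZ ^^ n) f)" for n f
    by (induction n) (simp_all add: 1 2 3)
  then show ?thesis by (simp add: Dm_def)
qed

lemma cpoly_pad:
  assumes "csupp N c" "N \<le> M"
  shows "cpoly M c = cpoly N c"
proof -
  have pad: "(\<Sum>i\<le>M. f i) = (\<Sum>i\<le>N. f i)" if "\<And>i. i > N \<Longrightarrow> f i = 0" for f :: "nat \<Rightarrow> complex"
    using that assms(2) by (intro sum.mono_neutral_right) auto
  have "(\<Sum>l\<le>M. c i j l * x^i * y^j * z^l) = (\<Sum>l\<le>N. c i j l * x^i * y^j * z^l)" for i j x y z
    using assms(1) by (intro pad) (auto simp: csupp_def)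
  moreover have "(\<Sum>j\<le>M. \<Sum>l\<le>N. c i j l * x^i * y^j * z^l) = (\<Sum>j\<le>N. \<Sum>l\<le>N. c i j l * x^i * y^j * z^l)" for i x y z
    using assms(1) by (intro pad) (auto simp: csupp_def)
  moreover have "(\<Sum>i\<le>M. \<Sum>j\<le>N. \<Sum>l\<le>N. c i j l * x^i * y^j * z^l) = (\<Sum>i\<le>N. \<Sum>j\<le>N. \<Sum>l\<le>N. c i j l * x^i * y^j * z^l)" for x y z
    using assms(1) by (intro pad) (auto simp: csupp_def)
  ultimately show ?thesis by (simp add: cpoly_def)
qed

section \<open>Closure properties of \<open>polyS\<close>\<close>

lemma polyS_iff: "f \<in> polyS \<longleftrightarrow> (\<exists>N c. csupp N c \<and> f = cpoly N c)"
proof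
  assume "f \<in> polyS"
  then obtain N c where f: "f = cpoly N c" unfolding polyS_def cpoly_def by blast
  let ?c = "\<lambda>i j l. if i \<le> N \<and> j \<le> N \<and> l \<le> N then c i j l else 0"
  have "cpoly N c = cpoly N ?c" unfolding cpoly_def by (intro ext sum.cong) auto
  moreover have "csupp N ?c" by (auto simp: csupp_def)
  ultimately show "\<exists>N c. csupp N c \<and> f = cpoly N c" using f by blast
qed (auto simp: polyS_def cpoly_def)

lemma cpoly_in_polyS: "cpoly N c \<in> polyS"
  unfolding polyS_def cpoly_def by blast

lemma polyS_add:
  assumes "f \<in> polyS" "g \<in> polyS"
  shows "(\<lambda>x y z. f x y z + g x y z) \<in> polyS"
proof -
  obtain N c M e where c: "csupp N c" "f = cpoly N c" and e: "csupp M e" "g = cpoly M e"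
    using assms unfolding polyS_iff by blast
  let ?L = "max N M"
  have "f = cpoly ?L c" "g = cpoly ?L e" using cpoly_pad c e by (metis max.cobounded1, metis max.cobounded2)
  then have "(\<lambda>x y z. f x y z + g x y z) = cpoly ?L (\<lambda>i j l. c i j l + e i j l)"
    by (simp add: cpoly_def sum.distrib algebra_simps)
  then show ?thesis by (simp only: cpoly_in_polyS)
qed

lemma polyS_cmult:
  assumes "f \<in> polyS"
  shows "(\<lambda>x y z. a * f x y z) \<in> polyS"
proof -
  obtain N c where "f = cpoly N c" using assms unfolding polyS_iff by blast
  then have "(\<lambda>x y z. a * f x y z) = cpoly N (\<lambda>i j l. a * c i j l)"
    by (simp add: cpoly_def sum_distrib_left algebra_simps)
  then show ?thesis by (simp only: cpoly_in_polyS)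
qed

lemma polyS_const: "(\<lambda>x y z. a) \<in> polyS"
proof -
  have "(\<lambda>x y z. a) = cpoly 0 (\<lambda>i j l. a)" by (simp add: cpoly_def)
  then show ?thesis by (simp only: cpoly_in_polyS)
qed

lemma polyS_X:
  assumes "f \<in> polyS"
  shows "(\<lambda>x y z. x * f x y z) \<in> polyS"
proof -
  obtain N c where c: "csupp N c" "f = cpoly N c" using assms unfolding polyS_iff by blast
  have f: "f = cpoly (Suc N) c" using cpoly_pad[OF c(1), of "Suc N"] c(2) by simp
  have z: "c (Suc N) j l = 0" for j l using c by (simp add: csupp_def)
  have "(\<lambda>x y z. x * f x y z) = cpoly (Suc N) (\<lambda>i j l. case i of 0 \<Rightarrow> 0 | Suc i \<Rightarrow> c i j l)"
    unfolding f cpoly_X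
    by (subst (2) sum.atMost_Suc_shift) (simp add: sum_distrib_left mult_ac z)
  then show ?thesis by (simp only: cpoly_in_polyS)
qed

lemma polyS_Y:
  assumes "f \<in> polyS"
  shows "(\<lambda>x y z. y * f x y z) \<in> polyS"
proof -
  obtain N c where c: "csupp N c" "f = cpoly N c" using assms unfolding polyS_iff by blast
  have f: "f = cpoly (Suc N) c" using cpoly_pad[OF c(1), of "Suc N"] c(2) by simp
  have z: "c i (Suc N) l = 0" for i l using c by (simp add: csupp_def)
  have "(\<lambda>x y z. y * f x y z) = cpoly (Suc N) (\<lambda>i j l. case j of 0 \<Rightarrow> 0 | Suc j \<Rightarrow> c i j l)"
    unfolding f cpoly_Y
    by (subst (2) sum.atMost_Suc_shift) (simp add: sum_distrib_left mult_ac z)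
  then show ?thesis by (simp only: cpoly_in_polyS)
qed

lemma polyS_Z:
  assumes "f \<in> polyS"
  shows "(\<lambda>x y z. z * f x y z) \<in> polyS"
proof -
  obtain N c where c: "csupp N c" "f = cpoly N c" using assms unfolding polyS_iff by blast
  have f: "f = cpoly (Suc N) c" using cpoly_pad[OF c(1), of "Suc N"] c(2) by simp
  have z: "c i j (Suc N) = 0" for i j using c by (simp add: csupp_def)
  have "(\<lambda>x y z. z * f x y z) = cpoly (Suc N) (\<lambda>i j l. case l of 0 \<Rightarrow> 0 | Suc l \<Rightarrow> c i j l)"
    unfolding f cpoly_Z
    by (subst (2) sum.atMost_Suc_shift) (simp add: sum_distrib_left mult_ac z)
  then show ?thesis by (simp only: cpoly_in_polyS)
qed

lemma hpoly_translate_polyS: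
  assumes "hpoly n F"
  shows "(\<lambda>x y z. F (vec3 x y z + p)) \<in> polyS"
  using assms
proof (induction rule: hpoly.induct)
  case (hpoly_coord n f i)
  let ?f = "\<lambda>x y z. f (vec3 x y z + p)"
  have "i = 1 \<or> i = 2 \<or> i = 3" using exhaust_3 by blast
  then have "(\<lambda>x y z. vec3 x y z $ i * ?f x y z) \<in> polyS"
    using polyS_X polyS_Y polyS_Z hpoly_coord.IH by auto
  from polyS_add[OF this polyS_cmult[OF hpoly_coord.IH, of "p $ i"]] show ?case
    by (simp add: algebra_simps)
qed (auto intro: polyS_const polyS_add)

lemma hpoly_polyS: "hpoly n F \<Longrightarrow> (\<lambda>x y z. F (vec3 x y z)) \<in> polyS"
  using hpoly_translate_polyS[of n F 0] by simp

lemma tangent_cone_translate_cpoly: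
  assumes g: "csupp N g" "translate p q r f = cpoly N g"
  shows "tangent_cone f n p q r u v w =
    (\<Sum>a\<le>n. \<Sum>b\<le>n. if a + b \<le> n then g a b (n - a - b) * u^a * v^b * w^(n - a - b) else 0)"
proof -
  have "Dm a b c f p q r = fact a * fact b * fact c * g a b c" for a b c
  proof -
    have "Dm a b c f p q r = translate p q r (Dm a b c f) 0 0 0" by (simp add: translate_def)
    also have "\<dots> = Dm a b c (translate p q r f) 0 0 0" by (simp only: Dm_translate)
    finally show ?thesis using Dm_cpoly_0[OF g(1)] by (simp add: g(2))
  qed
  then show ?thesis unfolding tangent_cone_def by (intro sum.cong) auto
qed

text \<open>The triple sum is collected by total degree; a box of side \<open>N\<close> holds no
  monomial of degree above \<open>3 * N\<close>.\<close>

lemma cpoly_scale_expand: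
  assumes g: "csupp N g" and R: "3 * N \<le> R"
  shows "cpoly N g (e * u) (e * v) (e * w) =
    (\<Sum>n\<le>R. (\<Sum>a\<le>n. \<Sum>b\<le>n. if a + b \<le> n then g a b (n - a - b) * u^a * v^b * w^(n - a - b) else 0) * e ^ n)"
proof -
  define t where "t = (\<lambda>a b c. g a b c * u^a * v^b * w^c * e ^ (a + b + c))"
  have t0: "t a b c = 0" if "a + b + c > R" for a b c
  proof -
    have "a > N \<or> b > N \<or> c > N" using that R by linarith
    then have "g a b c = 0" using g unfolding csupp_def by blast
    then show ?thesis by (simp add: t_def)
  qed
  have "cpoly N g (e * u) (e * v) (e * w) = cpoly R g (e * u) (e * v) (e * w)"
    using cpoly_pad[OF g, of R] R by simp
  also have "\<dots> = (\<Sum>a\<le>R. \<Sum>b\<le>R. \<Sum>c\<le>R. t a b c)"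
    unfolding cpoly_def t_def by (simp add: power_mult_distrib power_add mult_ac)
  also have "\<dots> = (\<Sum>a\<le>R. \<Sum>b\<le>R. \<Sum>n\<le>R. if a + b \<le> n then t a b (n - a - b) else 0)"
  proof (rule sum.cong[OF refl], rule sum.cong[OF refl])
    fix a b
    have "(\<Sum>n\<le>R. if a + b \<le> n then t a b (n - a - b) else 0) = (\<Sum>n\<in>{n \<in> {..R}. a + b \<le> n}. t a b (n - a - b))"
      by (rule sum.inter_filter[symmetric]) simp
    also have "\<dots> = (\<Sum>c\<in>{c. a + b + c \<le> R}. t a b c)"
      by (rule sum.reindex_bij_witness[of _ "\<lambda>c. a + b + c" "\<lambda>n. n - a - b"]) auto
    also have "\<dots> = (\<Sum>c\<le>R. t a b c)"
      by (rule sum.mono_neutral_left) (auto intro: t0)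
    finally show "(\<Sum>c\<le>R. t a b c) = (\<Sum>n\<le>R. if a + b \<le> n then t a b (n - a - b) else 0)" by simp
  qed
  also have "\<dots> = (\<Sum>a\<le>R. \<Sum>n\<le>R. \<Sum>b\<le>R. if a + b \<le> n then t a b (n - a - b) else 0)"
    by (rule sum.cong[OF refl], rule sum.swap)
  also have "\<dots> = (\<Sum>n\<le>R. \<Sum>a\<le>R. \<Sum>b\<le>R. if a + b \<le> n then t a b (n - a - b) else 0)"
    by (rule sum.swap)
  also have "\<dots> = (\<Sum>n\<le>R. \<Sum>a\<le>n. \<Sum>b\<le>n. if a + b \<le> n then t a b (n - a - b) else 0)"
  proof (rule sum.cong[OF refl])
    fix n assume n: "n \<in> {..R}"
    have "(\<Sum>b\<le>R. if a + b \<le> n then t a b (n - a - b) else 0) =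
        (\<Sum>b\<le>n. if a + b \<le> n then t a b (n - a - b) else 0)" for a
      using n by (intro sum.mono_neutral_right) auto
    moreover have "(\<Sum>a\<le>R. \<Sum>b\<le>n. if a + b \<le> n then t a b (n - a - b) else 0) =
        (\<Sum>a\<le>n. \<Sum>b\<le>n. if a + b \<le> n then t a b (n - a - b) else 0)"
      using n by (intro sum.mono_neutral_right) auto
    ultimately show "(\<Sum>a\<le>R. \<Sum>b\<le>R. if a + b \<le> n then t a b (n - a - b) else 0) =
        (\<Sum>a\<le>n. \<Sum>b\<le>n. if a + b \<le> n then t a b (n - a - b) else 0)" by simp
  qed
  also have "\<dots> = (\<Sum>n\<le>R. (\<Sum>a\<le>n. \<Sum>b\<le>n. if a + b \<le> n then g a b (n - a - b) * u^a * v^b * w^(n - a - b) else 0) * e ^ n)"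
    unfolding sum_distrib_right by (intro sum.cong refl) (auto simp: t_def)
  finally show ?thesis .
qed

text \<open>On lines through \<open>p\<close> the tangent cones are the Taylor coefficients. The
  cutoff \<open>R\<close> stays free above a threshold so that a coefficient of any given order can
  be compared.\<close>

lemma taylor_tangent_cone:
  assumes "hpoly n F"
  shows "\<exists>R0. \<forall>R\<ge>R0. \<forall>w e. F (p + e *s w) =
    (\<Sum>r\<le>R. tangent_cone (\<lambda>x y z. F (vec3 x y z)) r (p $ 1) (p $ 2) (p $ 3) (w $ 1) (w $ 2) (w $ 3) * e ^ r)"
proof -
  let ?f = "\<lambda>x y z. F (vec3 x y z)"
  have tr: "translate (p $ 1) (p $ 2) (p $ 3) ?f = (\<lambda>x y z. F (vec3 x y z + p))"
  proof -
    have "vec3 (x + p $ 1) (y + p $ 2) (z + p $ 3) = vec3 x y z + p" for x y z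
      by (simp add: vec_eq_iff forall_3)
    then show ?thesis by (simp add: translate_def)
  qed
  with hpoly_translate_polyS[OF assms] obtain N g where
    g: "csupp N g" "translate (p $ 1) (p $ 2) (p $ 3) ?f = cpoly N g"
    unfolding polyS_iff by metis
  have "F (p + e *s w) = cpoly N g (e * w $ 1) (e * w $ 2) (e * w $ 3)" for e w
  proof -
    have "vec3 (e * w $ 1) (e * w $ 2) (e * w $ 3) + p = p + e *s w"
      by (simp add: vec_eq_iff forall_3)
    then show ?thesis unfolding g(2)[symmetric] tr by (simp only:)
  qed
  then show ?thesis
    using cpoly_scale_expand[OF g(1)] tangent_cone_translate_cpoly[OF g]
    by (intro exI[of _ "3 * N"]) simp
qed

section \<open>Nodes and ordinary triple points\<close>

text \<open>In the induction a pencil \<open>v' + t *s v\<close> inside the kernel of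
  \<open>n\<close> meets each forbidden hyperplane in finitely many \<open>t\<close>. The choice
  \<open>n = 0\<close> gives plain avoidance.\<close>

lemma generic_vector:
  assumes "finite S" "\<And>s. s \<in> S \<Longrightarrow> \<exists>v. dot n v = 0 \<and> dot s v \<noteq> 0"
  shows "\<exists>v. dot n v = 0 \<and> (\<forall>s\<in>S. dot s v \<noteq> 0)"
  using assms
proof (induction S rule: finite_induct)
  case empty
  show ?case by (rule exI[of _ 0]) (simp add: dot_def)
next
  case (insert s S)
  then obtain v where v: "dot n v = 0" "\<And>s. s \<in> S \<Longrightarrow> dot s v \<noteq> 0" by auto
  obtain v' where v': "dot n v' = 0" "dot s v' \<noteq> 0" using insert.prems by blast
  let ?q = "\<lambda>s. [:dot s v', dot s v:]"
  have "finite (\<Union>s\<in>insert s S. {t. poly (?q s) t = 0})"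
    using insert.hyps v v' by (intro finite_UN_I poly_roots_finite) auto
  then obtain t where "t \<notin> (\<Union>s\<in>insert s S. {t. poly (?q s) t = 0})"
    using ex_new_if_finite[OF infinite_UNIV_char_0] by blast
  then have "\<forall>s\<in>insert s S. dot s (v' + t *s v) \<noteq> 0"
    by (auto simp: dot_add_right dot_scale_right)
  moreover have "dot n (v' + t *s v) = 0" using v v' by (simp add: dot_add_right dot_scale_right)
  ultimately show ?case by blast
qed

lemma covector_proportional:
  assumes "n \<noteq> 0" "\<And>v. dot n v = 0 \<Longrightarrow> dot s v = 0"
  shows "\<exists>c. s = c *s n"
proof -
  obtain i where i: "n $ i \<noteq> 0" using assms(1) by (auto simp: vec_eq_iff)
  have ax: "dot m (axis i 1) = m $ i" for m
    using exhaust_3[of i] by (auto simp: dot_def axis_def)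
  have "dot s x = s $ i / n $ i * dot n x" for x
  proof -
    have "dot n (x + (- dot n x / n $ i) *s axis i 1) = 0"
      using i by (simp only: dot_add_right dot_scale_right ax) simp
    from assms(2)[OF this] show ?thesis by (simp only: dot_add_right dot_scale_right ax) (simp add: field_simps)
  qed
  moreover have "dot (s - c *s n) x = dot s x - c * dot n x" for c x
    by (simp add: dot_def algebra_simps)
  ultimately have "dot (s - (s $ i / n $ i) *s n) x = 0" for x by simp
  then have "s - (s $ i / n $ i) *s n = 0" by (rule dot_eq_zeroD)
  then show ?thesis by (intro exI[of _ "s $ i / n $ i"]) simp
qed

text \<open>Unique factorisation for products of linear forms. A generic vector in the kernel of
  \<open>L a\<close> would annihilate only the left side unless some \<open>g i\<close> is a
  multiple of \<open>L a\<close>; as the \<open>L a\<close> are pairwise non-proportional and both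
  products have \<open>r\<close> factors, this matching is a bijection.\<close>

lemma proportional_factors:
  fixes L :: "nat \<Rightarrow> complex^3" and g :: "'a \<Rightarrow> complex^3"
  assumes I: "finite I" "card I = r" and g: "\<And>i. i \<in> I \<Longrightarrow> g i \<noteq> 0"
    and L: "\<And>a. a < r \<Longrightarrow> L a \<noteq> 0" "\<And>a a' c. a < r \<Longrightarrow> a' < r \<Longrightarrow> a \<noteq> a' \<Longrightarrow> L a \<noteq> c *s L a'"
    and eq: "\<And>w. \<kappa> * (\<Prod>a<r. dot (L a) w) = \<mu> * (\<Prod>i\<in>I. dot (g i) w)" and "\<mu> \<noteq> 0"
    and ij: "i \<in> I" "j \<in> I" "i \<noteq> j"
  shows "g i \<noteq> c *s g j"
proof
  assume c: "g i = c *s g j"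
  have "\<exists>i\<in>I. \<exists>c. g i = c *s L a" if a: "a < r" for a
  proof (rule ccontr)
    assume "\<not> ?thesis"
    then have "\<exists>v. dot (L a) v = 0 \<and> dot s v \<noteq> 0" if "s \<in> g ` I" for s
      using that covector_proportional[OF L(1)[OF a]] by blast
    then obtain v where v: "dot (L a) v = 0" "\<forall>s\<in>g ` I. dot s v \<noteq> 0"
      using generic_vector[of "g ` I" "L a"] I by blast
    have "(\<Prod>a<r. dot (L a) v) = 0" using a v by auto
    moreover have "(\<Prod>i\<in>I. dot (g i) v) \<noteq> 0" using v I by auto
    ultimately show False using eq[of v] \<open>\<mu> \<noteq> 0\<close> by (metis mult_eq_0_iff)
  qed
  then obtain \<sigma> d where \<sigma>: "\<And>a. a < r \<Longrightarrow> \<sigma> a \<in> I" "\<And>a. a < r \<Longrightarrow> g (\<sigma> a) = d a *s L a" by metis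
  have d: "d a \<noteq> 0" if "a < r" for a using \<sigma>[OF that] g[of "\<sigma> a"] by auto
  have Lg: "L a = (1 / d a) *s g (\<sigma> a)" if "a < r" for a
    using \<sigma>(2)[OF that] d[OF that] by simp
  have "inj_on \<sigma> {..<r}"
  proof (rule inj_onI, rule ccontr)
    fix a a' assume a: "a \<in> {..<r}" "a' \<in> {..<r}" "\<sigma> a = \<sigma> a'" "a \<noteq> a'"
    then have "L a = (1 / d a * d a') *s L a'" using Lg[of a] \<sigma>(2)[of a'] by simp
    then show False using L(2)[of a a'] a by blast
  qed
  then have im: "\<sigma> ` {..<r} = I" using \<sigma>(1) I
    by (intro card_subset_eq) (auto simp: card_image)
  obtain a a' where a: "a < r" "a' < r" "\<sigma> a = i" "\<sigma> a' = j"
    using im ij(1,2) by (metis imageE lessThan_iff)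
  then have "L a = (1 / d a * c * d a') *s L a'" using Lg[of a] \<sigma>(2)[of a'] c by simp
  moreover have "a \<noteq> a'" using a ij by auto
  ultimately show False using L(2)[of a a'] a by blast
qed

definition form_prod :: "nat \<Rightarrow> (nat \<Rightarrow> complex^3 \<Rightarrow> complex^3 \<Rightarrow> complex) \<Rightarrow> complex^3 \<Rightarrow> complex" where
  "form_prod k b v = (\<Prod>i<k. b i v v)"

lemma hpoly_form_prod:
  assumes "\<And>i. i < k \<Longrightarrow> symmetric_bilinear (b i)"
  shows "hpoly (2 * k) (form_prod k b)"
  using hpoly_prod[of "{..<k}" 2 "\<lambda>i v. b i v v"] symmetric_bilinear.hpoly_form[OF assms]
  by (simp add: form_prod_def[abs_def])

text \<open>Along \<open>p + e *s w\<close> exactly the conics through \<open>p\<close> contribute a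
  factor \<open>e\<close>. So the product vanishes to order \<open>card I\<close> for generic
  \<open>w\<close>, with leading coefficient a nonzero constant times the product of the gradients;
  comparing it with the tangent cone gives both the number of conics and the distinctness of their
  tangents.\<close>

lemma ordinary_point_conics:
  assumes nd: "\<And>i. i < k \<Longrightarrow> nondegenerate (b i)"
    and ord: "ordinary_mpoint (\<lambda>x y z. form_prod k b (vec3 x y z)) r (p $ 1) (p $ 2) (p $ 3)"
  defines "I \<equiv> {i. i < k \<and> b i p p = 0}"
  shows "card I = r"
    and "\<lbrakk>i \<in> I; j \<in> I; i \<noteq> j\<rbrakk> \<Longrightarrow> \<not> (\<exists>c. \<forall>w. b i p w = c * b j p w)"
proof -
  let ?f = "\<lambda>x y z. form_prod k b (vec3 x y z)"
  define T where "T = (\<lambda>n (w :: complex^3). tangent_cone ?f n (p $ 1) (p $ 2) (p $ 3) (w $ 1) (w $ 2) (w $ 3))"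
  have sb: "symmetric_bilinear (b i)" if "i < k" for i using nd[OF that] nondegenerate.axioms by blast
  have p0: "p \<noteq> 0" using ord by (auto simp: ordinary_mpoint_def)
  have T0: "T n w = 0" if "n < r" for n w
    using ord that unfolding T_def tangent_cone_def ordinary_mpoint_def by (intro sum.neutral ballI) auto
  obtain L' \<kappa> where \<kappa>: "\<kappa> \<noteq> 0" and L'1: "\<forall>a<r. L' a \<noteq> (0, 0, 0)"
    and L'2: "\<forall>a<r. \<forall>a'<r. a \<noteq> a' \<longrightarrow> \<not> proportional3 (L' a) (L' a')"
    and L'3: "\<forall>u v w. tangent_cone ?f r (p $ 1) (p $ 2) (p $ 3) u v w =
      \<kappa> * (\<Prod>a<r. fst (L' a) * u + fst (snd (L' a)) * v + snd (snd (L' a)) * w)"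
    using ord unfolding ordinary_mpoint_def by (elim conjE exE) (rule that)
  define L where "L = (\<lambda>a. vec3 (fst (L' a)) (fst (snd (L' a))) (snd (snd (L' a))))"
  have Tr: "T r w = \<kappa> * (\<Prod>a<r. dot (L a) w)" for w by (simp add: T_def L'3 L_def dot_def)
  have L0: "L a \<noteq> 0" if "a < r" for a
    using L'1 that by (cases "L' a") (auto simp: L_def vec_eq_iff forall_3)
  have Lp: "L a \<noteq> c *s L a'" if "a < r" "a' < r" "a \<noteq> a'" for a a' c
    using L'2[rule_format, OF that] by (auto simp: L_def vec_eq_iff forall_3 proportional3_def)
  have finI: "finite I" by (simp add: I_def)
  define m where "m = card I"
  define g0 where "g0 = (\<Prod>i\<in>{..<k} - I. b i p p)"
  have g0: "g0 \<noteq> 0" by (auto simp: g0_def I_def)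
  define Q where "Q = (\<lambda>w. (\<Prod>i\<in>I. [:2 * b i p w, b i w w:]) *
    (\<Prod>i\<in>{..<k} - I. [:b i p p, 2 * b i p w, b i w w:]))"
  have PQ: "(\<Prod>i<k. [:b i p p, 2 * b i p w, b i w w:]) = monom 1 m * Q w" for w
  proof -
    have "(\<Prod>i<k. [:b i p p, 2 * b i p w, b i w w:]) =
        (\<Prod>i\<in>{..<k} - I. [:b i p p, 2 * b i p w, b i w w:]) * (\<Prod>i\<in>I. [:b i p p, 2 * b i p w, b i w w:])"
      by (rule prod.subset_diff) (auto simp: I_def)
    also have "(\<Prod>i\<in>I. [:b i p p, 2 * b i p w, b i w w:]) = (\<Prod>i\<in>I. monom 1 1 * [:2 * b i p w, b i w w:])"
      by (intro prod.cong) (auto simp: I_def monom_Suc)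
    also have "\<dots> = monom 1 m * (\<Prod>i\<in>I. [:2 * b i p w, b i w w:])"
      by (subst prod.distrib) (simp add: monom_power m_def)
    finally show ?thesis by (simp add: Q_def mult_ac)
  qed
  have Q0: "coeff (Q w) 0 = 2 ^ m * g0 * (\<Prod>i\<in>I. b i p w)" for w
  proof -
    have "coeff (Q w) 0 = poly (Q w) 0" by (simp add: poly_0_coeff_0)
    then show ?thesis by (simp add: Q_def poly_prod prod.distrib g0_def m_def)
  qed
  have "\<exists>R0. \<forall>R\<ge>R0. \<forall>w e. form_prod k b (p + e *s w) = (\<Sum>n\<le>R. T n w * e ^ n)"
    unfolding T_def by (rule taylor_tangent_cone[OF hpoly_form_prod[OF sb]])
  then obtain R0 where R0: "\<And>R w e. R \<ge> R0 \<Longrightarrow> form_prod k b (p + e *s w) = (\<Sum>n\<le>R. T n w * e ^ n)"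
    by blast
  have coeff: "coeff (monom 1 m * Q w) n = T n w" for n w
  proof -
    let ?R = "max R0 n"
    have "poly (monom 1 m * Q w) e = poly (\<Sum>n\<le>?R. monom (T n w) n) e" for e
    proof -
      have "b i (p + e *s w) (p + e *s w) = poly [:b i p p, 2 * b i p w, b i w w:] e" if "i < k" for i
      proof -
        interpret symmetric_bilinear "b i" using sb that .
        show ?thesis using sym[of w p] by (simp add: bilin algebra_simps)
      qed
      then have "form_prod k b (p + e *s w) = poly (\<Prod>i<k. [:b i p p, 2 * b i p w, b i w w:]) e"
        unfolding form_prod_def poly_prod by (intro prod.cong) auto
      then show ?thesis using R0[of ?R e w] by (simp add: PQ poly_sum poly_monom)
    qed
    then have "poly (monom 1 m * Q w) = poly (\<Sum>n\<le>?R. monom (T n w) n)" by blast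
    then have "monom 1 m * Q w = (\<Sum>n\<le>?R. monom (T n w) n)" by (simp only: poly_eq_poly_eq_iff)
    then have "coeff (monom 1 m * Q w) n = (\<Sum>i\<le>?R. if i = n then T i w else 0)"
      by (simp add: coeff_sum)
    then show ?thesis by simp
  qed
  have "\<exists>g. \<forall>w. dot g w = b i p w" if "i \<in> I" for i
    using symmetric_bilinear.covector_form sb that by (auto simp: I_def)
  then obtain g where g: "\<And>i w. i \<in> I \<Longrightarrow> dot (g i) w = b i p w" by metis
  have gne: "g i \<noteq> 0" if i: "i \<in> I" for i
  proof
    assume "g i = 0"
    then have "b i p w = 0" for w using g[OF i, of w] by (simp add: dot_def)
    then show False using nondegenerate.nondeg[OF nd p0] i by (auto simp: I_def)
  qed
  have ex: "\<exists>v. dot 0 v = 0 \<and> dot s v \<noteq> 0" if "s \<noteq> 0" for s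
    using dot_eq_zeroD[of s] that by (auto simp: dot_def)
  have "m \<le> r"
  proof (rule ccontr)
    assume "\<not> m \<le> r"
    obtain w where w: "\<forall>s\<in>L ` {..<r}. dot s w \<noteq> 0"
      using generic_vector[of "L ` {..<r}" 0] ex L0 by blast
    then have "T r w \<noteq> 0" using \<kappa> by (simp add: Tr)
    then show False using coeff[of w r] \<open>\<not> m \<le> r\<close> by (simp add: coeff_monom_mult)
  qed
  moreover have "\<not> m < r"
  proof
    assume "m < r"
    obtain w where w: "\<forall>s\<in>g ` I. dot s w \<noteq> 0"
      using generic_vector[of "g ` I" 0] ex gne finI by blast
    then have "coeff (Q w) 0 \<noteq> 0" using g g0 finI by (simp add: Q0)
    then show False using coeff[of w m] T0[OF \<open>m < r\<close>] by (simp add: coeff_monom_mult)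
  qed
  ultimately have mr: "m = r" by simp
  then show "card I = r" by (simp add: m_def)
  assume ij: "i \<in> I" "j \<in> I" "i \<noteq> j"
  have eq: "\<kappa> * (\<Prod>a<r. dot (L a) w) = 2 ^ m * g0 * (\<Prod>i\<in>I. dot (g i) w)" for w
    using coeff[of w m] Tr[of w] Q0[of w] mr g by (simp add: coeff_monom_mult)
  show "\<not> (\<exists>c. \<forall>w. b i p w = c * b j p w)"
  proof
    assume "\<exists>c. \<forall>w. b i p w = c * b j p w"
    then obtain c where "\<And>w. dot (g i) w = c * dot (g j) w" using g ij by auto
    then have "dot (g i - c *s g j) w = 0" for w by (simp add: dot_def algebra_simps)
    then have "g i - c *s g j = 0" by (rule dot_eq_zeroD)
    then show False
      using proportional_factors[of I r g L \<kappa> "2 ^ m * g0" i j c] finI mr m_def gne L0 Lp eq g0 ij by auto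
  qed
qed

section \<open>Syzygies as tangent covector fields\<close>

text \<open>Gaussian elimination: an equation with a nonzero coefficient removes one unknown from
  all the others.\<close>

lemma homogeneous_linear_system:
  fixes a :: "'e \<Rightarrow> 'i \<Rightarrow> complex"
  assumes "finite E" "finite I" "card E < card I"
  shows "\<exists>x. (\<exists>i\<in>I. x i \<noteq> 0) \<and> (\<forall>e\<in>E. (\<Sum>i\<in>I. x i * a e i) = 0)"
  using assms
proof (induction E arbitrary: I a rule: finite_induct)
  case empty
  then have "I \<noteq> {}" by auto
  then show ?case by (intro exI[of _ "\<lambda>i. 1"]) auto
next
  case (insert e E)
  show ?case
  proof (cases "\<forall>i\<in>I. a e i = 0")
    case True
    have "finite I" "card E < card I" using insert.prems insert.hyps by auto
    from insert.IH[OF this, of a] obtain x where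
      "\<exists>i\<in>I. x i \<noteq> 0" "\<forall>e\<in>E. (\<Sum>i\<in>I. x i * a e i) = 0" by blast
    with True show ?thesis by (intro exI[of _ x]) auto
  next
    case False
    then obtain i0 where i0: "i0 \<in> I" "a e i0 \<noteq> 0" by blast
    have "finite (I - {i0})" "card E < card (I - {i0})"
      using insert.prems insert.hyps i0 by (auto simp: card_Diff_singleton)
    from insert.IH[OF this, of "\<lambda>e' i. a e' i - a e' i0 / a e i0 * a e i"] obtain x where x: "\<exists>i\<in>I - {i0}. x i \<noteq> 0"
      "\<forall>e'\<in>E. (\<Sum>i\<in>I - {i0}. x i * (a e' i - a e' i0 / a e i0 * a e i)) = 0"
      by blast
    define y where "y = x(i0 := - (\<Sum>i\<in>I - {i0}. x i * a e i) / a e i0)"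
    have y: "(\<Sum>i\<in>I. y i * a e' i) = y i0 * a e' i0 + (\<Sum>i\<in>I - {i0}. x i * a e' i)" for e'
    proof -
      have "(\<Sum>i\<in>I. y i * a e' i) = y i0 * a e' i0 + (\<Sum>i\<in>I - {i0}. y i * a e' i)"
        using insert.prems(1) i0(1) by (simp add: sum.remove)
      also have "(\<Sum>i\<in>I - {i0}. y i * a e' i) = (\<Sum>i\<in>I - {i0}. x i * a e' i)"
        by (intro sum.cong) (auto simp: y_def)
      finally show ?thesis .
    qed
    have "(\<Sum>i\<in>I. y i * a e' i) = 0" if e': "e' \<in> E" for e'
    proof -
      have "0 = (\<Sum>i\<in>I - {i0}. x i * a e' i - a e' i0 / a e i0 * (x i * a e i))"
        using x(2) e' by (simp add: algebra_simps)
      also have "\<dots> = (\<Sum>i\<in>I - {i0}. x i * a e' i) - a e' i0 / a e i0 * (\<Sum>i\<in>I - {i0}. x i * a e i)"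
        by (simp only: sum_subtractf sum_distrib_left)
      finally show ?thesis unfolding y by (simp add: y_def field_simps)
    qed
    moreover have "(\<Sum>i\<in>I. y i * a e i) = 0" unfolding y using i0 by (simp add: y_def)
    moreover have "\<exists>i\<in>I. y i \<noteq> 0" using x(1) by (auto simp: y_def)
    ultimately show ?thesis by (intro exI[of _ y]) auto
  qed
qed

definition crs :: "complex^3 \<Rightarrow> complex^3 \<Rightarrow> complex^3" where
  "crs v w = vec3 (v $ 2 * w $ 3 - v $ 3 * w $ 2) (v $ 3 * w $ 1 - v $ 1 * w $ 3) (v $ 1 * w $ 2 - v $ 2 * w $ 1)"

lemma dot_crs_self: "dot (crs v w) v = 0"
  by (simp add: dot_def crs_def algebra_simps)

lemma crs_parallel:
  assumes "g \<noteq> 0" "dot g p = 0" "dot g t = 0"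
  shows "\<exists>c. crs p t = c *s g"
proof (rule covector_proportional[OF assms(1)])
  fix v assume v: "dot g v = 0"
  \<comment> \<open>Cramer's rule: the expansion of \<open>g\<close> in the basis dual to
    \<open>p\<close>, \<open>t\<close>, \<open>v\<close>, multiplied by their determinant.\<close>
  have "dot (crs p t) v *s g = dot g p *s crs t v + dot g t *s crs v p + dot g v *s crs p t"
    by (simp add: vec_eq_iff forall_3 dot_def crs_def algebra_simps)
  then have "dot (crs p t) v *s g = 0" using assms v by simp
  then show "dot (crs p t) v = 0" using assms(1) by simp
qed

lemma crs_eq_zeroD:
  assumes "crs v t = 0" "v \<noteq> 0"
  shows "\<exists>c. t = c *s v"
proof -
  obtain i where i: "v $ i \<noteq> 0" using assms(2) by (auto simp: vec_eq_iff)
  have e: "v $ 2 * t $ 3 = v $ 3 * t $ 2" "v $ 3 * t $ 1 = v $ 1 * t $ 3" "v $ 1 * t $ 2 = v $ 2 * t $ 1"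
    using assms(1) by (auto simp: crs_def vec_eq_iff forall_3)
  have "t = (t $ i / v $ i) *s v"
    using i e exhaust_3[of i] by (auto simp: vec_eq_iff forall_3 field_simps)
  then show ?thesis by blast
qed

lemma homog_imp_hp:
  assumes "homog d f"
  shows "hp d (\<lambda>v. f (v $ 1) (v $ 2) (v $ 3))"
proof (cases "d < 0")
  case True
  with assms show ?thesis by (simp add: homog_def zero_pf_def hp_def)
next
  case False
  with assms obtain c :: "nat \<Rightarrow> nat \<Rightarrow> complex" where
    f: "f = (\<lambda>x y z. \<Sum>i\<le>nat d. \<Sum>j\<le>nat d. if i + j \<le> nat d then c i j * x^i * y^j * z^(nat d - i - j) else 0)"
    by (auto simp: homog_def)
  have "hpoly (nat d) (\<lambda>v. if i + j \<le> nat d then c i j * (v $ 1)^i * (v $ 2)^j * (v $ 3)^(nat d - i - j) else 0)" for i j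
  proof (cases "i + j \<le> nat d")
    case True
    have "hpoly (i + (j + (nat d - i - j))) (\<lambda>v. c i j * ((v $ 1)^i * ((v $ 2)^j * (v $ 3)^(nat d - i - j))))"
      by (intro hpoly_cmult hpoly_mult hpoly_nth_power)
    then show ?thesis using True by (simp add: mult.assoc)
  qed (simp add: hpoly_zero)
  then have "hpoly (nat d) (\<lambda>v. f (v $ 1) (v $ 2) (v $ 3))"
    unfolding f by (intro hpoly_sum)
  then show ?thesis using False by (simp add: hp_def)
qed

lemma homog_1_linear:
  assumes "homog 1 f"
  shows "\<exists>c. \<forall>v. f (v $ 1) (v $ 2) (v $ 3) = dot c v"
proof -
  obtain c :: "nat \<Rightarrow> nat \<Rightarrow> complex" where
    "f = (\<lambda>x y z. \<Sum>i\<le>1. \<Sum>j\<le>1. if i + j \<le> 1 then c i j * x^i * y^j * z^(1 - i - j) else 0)"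
    using assms by (auto simp: homog_def)
  then show ?thesis by (intro exI[of _ "vec3 (c 1 0) (c 0 1) (c 0 0)"]) (simp add: dot_def)
qed

lemma homog_2_form:
  assumes "homog 2 f"
  shows "\<exists>b. symmetric_bilinear b \<and> (\<forall>x y z. f x y z = b (vec3 x y z) (vec3 x y z))"
proof -
  obtain c :: "nat \<Rightarrow> nat \<Rightarrow> complex" where
    f: "f = (\<lambda>x y z. \<Sum>i\<le>2. \<Sum>j\<le>2. if i + j \<le> 2 then c i j * x^i * y^j * z^(2 - i - j) else 0)"
    using assms unfolding homog_def nat_numeral by auto
  define b :: "complex^3 \<Rightarrow> complex^3 \<Rightarrow> complex" where
    "b = (\<lambda>v w. c 2 0 * (v $ 1 * w $ 1) + c 0 2 * (v $ 2 * w $ 2) + c 0 0 * (v $ 3 * w $ 3) +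
      c 1 1 / 2 * (v $ 1 * w $ 2 + v $ 2 * w $ 1) + c 1 0 / 2 * (v $ 1 * w $ 3 + v $ 3 * w $ 1) +
      c 0 1 / 2 * (v $ 2 * w $ 3 + v $ 3 * w $ 2))"
  have "symmetric_bilinear b" by unfold_locales (simp_all add: b_def algebra_simps add_divide_distrib)
  moreover have "f x y z = b (vec3 x y z) (vec3 x y z)" for x y z
    by (simp add: f b_def numeral_2_eq_2 algebra_simps)
  ultimately show ?thesis by blast
qed

section \<open>The differential of a product of quadratic forms\<close>

lemma deriv_form_prod:
  assumes "\<And>i. i < k \<Longrightarrow> symmetric_bilinear (b i)"
  shows "deriv (\<lambda>t. form_prod k b (u + t *s e)) x =
    (\<Sum>i<k. 2 * b i (u + x *s e) e * (\<Prod>j\<in>{..<k} - {i}. b j (u + x *s e) (u + x *s e)))"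
  unfolding form_prod_def
proof (rule DERIV_imp_deriv, rule has_field_derivative_prod)
  fix i assume "i \<in> {..<k}"
  then interpret symmetric_bilinear "b i" using assms by auto
  have "((\<lambda>t. b i u u + 2 * t * b i u e + t\<^sup>2 * b i e e) has_field_derivative 2 * b i (u + x *s e) e) (at x)"
    by (auto intro!: derivative_eq_intros simp: bilin algebra_simps)
  moreover have "b i (u + t *s e) (u + t *s e) = b i u u + 2 * t * b i u e + t\<^sup>2 * b i e e" for t
    using sym[of e u] by (simp add: bilin algebra_simps power2_eq_square)
  ultimately show "((\<lambda>t. b i (u + t *s e) (u + t *s e)) has_field_derivative 2 * b i (u + x *s e) e) (at x)"
    by simp
qed

text \<open>The differential of \<open>form_prod k b\<close> at \<open>v\<close> in direction
  \<open>w\<close>. A syzygy of the partial derivatives is a field that it annihilates.\<close>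

definition grad_form_prod :: "nat \<Rightarrow> (nat \<Rightarrow> complex^3 \<Rightarrow> complex^3 \<Rightarrow> complex) \<Rightarrow> complex^3 \<Rightarrow> complex^3 \<Rightarrow> complex" where
  "grad_form_prod k b v w = (\<Sum>i<k. 2 * b i v w * (\<Prod>j\<in>{..<k} - {i}. b j v v))"

lemma partials_form_prod:
  assumes "\<And>i. i < k \<Longrightarrow> symmetric_bilinear (b i)"
  defines "f \<equiv> \<lambda>x y z. form_prod k b (vec3 x y z)"
  shows "dX f x y z = grad_form_prod k b (vec3 x y z) (axis 1 1)"
    and "dY f x y z = grad_form_prod k b (vec3 x y z) (axis 2 1)"
    and "dZ f x y z = grad_form_prod k b (vec3 x y z) (axis 3 1)"
proof -
  have X: "vec3 t y z = vec3 0 y z + t *s axis 1 1" for t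
    by (simp add: vec_eq_iff forall_3 axis_def)
  show "dX f x y z = grad_form_prod k b (vec3 x y z) (axis 1 1)"
    using deriv_form_prod[of k b "vec3 0 y z" "axis 1 1" x, OF assms(1)]
    by (simp add: dX_def f_def grad_form_prod_def X[symmetric])
  have Y: "vec3 x t z = vec3 x 0 z + t *s axis 2 1" for t
    by (simp add: vec_eq_iff forall_3 axis_def)
  show "dY f x y z = grad_form_prod k b (vec3 x y z) (axis 2 1)"
    using deriv_form_prod[of k b "vec3 x 0 z" "axis 2 1" y, OF assms(1)]
    by (simp add: dY_def f_def grad_form_prod_def Y[symmetric])
  have Z: "vec3 x y t = vec3 x y 0 + t *s axis 3 1" for t
    by (simp add: vec_eq_iff forall_3 axis_def)
  show "dZ f x y z = grad_form_prod k b (vec3 x y z) (axis 3 1)"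
    using deriv_form_prod[of k b "vec3 x y 0" "axis 3 1" z, OF assms(1)]
    by (simp add: dZ_def f_def grad_form_prod_def Z[symmetric])
qed

lemma grad_form_prod_linear:
  assumes "\<And>i. i < k \<Longrightarrow> symmetric_bilinear (b i)"
  shows "grad_form_prod k b v (w + w') = grad_form_prod k b v w + grad_form_prod k b v w'"
    and "grad_form_prod k b v (c *s w) = c * grad_form_prod k b v w"
  unfolding grad_form_prod_def
  by (simp_all add: symmetric_bilinear.add_right[OF assms] symmetric_bilinear.scale_right[OF assms]
      sum.distrib[symmetric] sum_distrib_left algebra_simps)

lemma jac_form_prod:
  assumes "\<And>i. i < k \<Longrightarrow> symmetric_bilinear (b i)"
  defines "f \<equiv> \<lambda>x y z. form_prod k b (vec3 x y z)"
  shows "(\<Sum>l<3. jac f l x y z * u l) = grad_form_prod k b (vec3 x y z) (vec3 (u 0) (u 1) (u 2))"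
proof -
  have "vec3 (u 0) (u 1) (u 2) = u 0 *s axis 1 1 + u 1 *s axis 2 1 + u 2 *s axis 3 1"
    by (simp add: vec_eq_iff forall_3 axis_def)
  then show ?thesis
    using partials_form_prod[of k b x y z, OF assms(1)]
    by (simp add: f_def jac_def numeral_3_eq_3 numeral_2_eq_2 grad_form_prod_linear[OF assms(1)] algebra_simps)
qed

text \<open>Euler's identity for a form of degree \<open>2 * k\<close>.\<close>

lemma grad_form_prod_self:
  "grad_form_prod k b v v = 2 * of_nat k * form_prod k b v"
proof -
  have "grad_form_prod k b v v = (\<Sum>i<k. 2 * form_prod k b v)"
    unfolding grad_form_prod_def form_prod_def
    by (intro sum.cong refl) (simp add: prod.remove mult.assoc)
  then show ?thesis by simp
qed

lemma grad_form_prod_on_conic: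
  assumes "i < k" "b i p p = 0"
  shows "grad_form_prod k b p w = 2 * b i p w * (\<Prod>j\<in>{..<k} - {i}. b j p p)"
proof -
  have "(\<Prod>j\<in>{..<k} - {i'}. b j p p) = 0" if "i' \<noteq> i" for i'
    using assms that by (intro prod_zero) auto
  then have "grad_form_prod k b p w = (\<Sum>i'<k. if i' = i then 2 * b i p w * (\<Prod>j\<in>{..<k} - {i}. b j p p) else 0)"
    unfolding grad_form_prod_def by (intro sum.cong) auto
  then show ?thesis using assms by simp
qed

text \<open>A nonzero vector in the radical of \<open>b\<close> is a singular point of the conic.
  The conic is viewed as a product with one factor, so that the general formulas for the partials
  apply.\<close>

lemma smooth_imp_nondegenerate:
  assumes sb: "symmetric_bilinear b" and q: "\<And>x y z. q x y z = b (vec3 x y z) (vec3 x y z)"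
    and "smooth_curve q"
  shows "nondegenerate b"
proof -
  interpret symmetric_bilinear b by fact
  show ?thesis
  proof
    fix v :: "complex^3" assume "v \<noteq> 0"
    show "\<exists>w. b v w \<noteq> 0"
    proof (rule ccontr)
      assume "\<not> ?thesis"
      then have z: "b v w = 0" for w by blast
      have qf: "q = (\<lambda>x y z. form_prod 1 (\<lambda>i. b) (vec3 x y z))" by (simp add: q form_prod_def fun_eq_iff)
      have "(v $ 1, v $ 2, v $ 3) \<noteq> (0, 0, 0)" using \<open>v \<noteq> 0\<close> by (auto simp: vec_eq_iff forall_3)
      then have "is_sing_point q (v $ 1) (v $ 2) (v $ 3)"
        using partials_form_prod[of 1 "\<lambda>i. b" "v $ 1" "v $ 2" "v $ 3"] sb z
        unfolding is_sing_point_def qf by (simp add: grad_form_prod_def form_prod_def)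
      then show False using assms(3) unfolding smooth_curve_def by blast
    qed
  qed
qed

lemma common_point_is_singular:
  assumes "\<And>i. i < k \<Longrightarrow> symmetric_bilinear (b i)" "p \<noteq> 0"
    "i < k" "j < k" "i \<noteq> j" "b i p p = 0" "b j p p = 0"
  shows "is_sing_point (\<lambda>x y z. form_prod k b (vec3 x y z)) (p $ 1) (p $ 2) (p $ 3)"
proof -
  have "(\<Prod>j\<in>{..<k} - {i}. b j p p) = 0" using assms by (intro prod_zero) auto
  then have "grad_form_prod k b p w = 0" for w using grad_form_prod_on_conic[of i k b p w] assms by simp
  moreover have "form_prod k b p = 0" using assms(3,6) unfolding form_prod_def by (intro prod_zero) auto
  moreover have "(p $ 1, p $ 2, p $ 3) \<noteq> (0, 0, 0)" using \<open>p \<noteq> 0\<close> by (auto simp: vec_eq_iff forall_3)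
  ultimately show ?thesis
    unfolding is_sing_point_def using partials_form_prod[of k b "p $ 1" "p $ 2" "p $ 3", OF assms(1)] by simp
qed

text \<open>A point on two of the conics is singular on the product, so it is a node or an ordinary
  triple point; its multiplicity and its tangents then give the two conditions.\<close>

lemma conic_arrangementI:
  assumes nd: "\<And>i. i < k \<Longrightarrow> nondegenerate (b i)"
    and sing: "\<And>x y z. is_sing_point (\<lambda>x y z. form_prod k b (vec3 x y z)) x y z \<Longrightarrow>
      is_node (\<lambda>x y z. form_prod k b (vec3 x y z)) x y z \<or>
      is_ordinary_triple_point (\<lambda>x y z. form_prod k b (vec3 x y z)) x y z"
  shows "conic_arrangement k b"
proof (rule conic_arrangement.intro)
  have sb: "symmetric_bilinear (b i)" if "i < k" for i using nd[OF that] nondegenerate.axioms by blast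
  let ?f = "\<lambda>x y z. form_prod k b (vec3 x y z)"
  have ord: "\<exists>r\<le>3. ordinary_mpoint ?f r (p $ 1) (p $ 2) (p $ 3)"
    if "p \<noteq> 0" "i < k" "j < k" "i \<noteq> j" "b i p p = 0" "b j p p = 0" for p i j
    using sing[OF common_point_is_singular[OF sb that]]
  proof
    assume "is_node ?f (p $ 1) (p $ 2) (p $ 3)"
    then show ?thesis by (intro exI[of _ 2]) simp
  next
    assume "is_ordinary_triple_point ?f (p $ 1) (p $ 2) (p $ 3)"
    then show ?thesis by (intro exI[of _ 3]) simp
  qed
  show "nondegenerate (b i)" if "i < k" for i using nd that .
  show "\<not> (\<exists>c. \<forall>w. b i p w = c * b j p w)"
    if H: "i < k" "j < k" "i \<noteq> j" "p \<noteq> 0" "b i p p = 0" "b j p p = 0" for i j p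
  proof -
    obtain r where "ordinary_mpoint ?f r (p $ 1) (p $ 2) (p $ 3)" using ord[OF H(4,1,2,3,5,6)] by blast
    from ordinary_point_conics(2)[OF nd this, of i j] show ?thesis using H by simp
  qed
  show "card {j. j < k \<and> b j p p = 0} \<le> 3" if p: "p \<noteq> 0" for p
  proof (rule ccontr)
    assume c: "\<not> ?thesis"
    then have "\<not> card {j. j < k \<and> b j p p = 0} \<le> Suc 0" by simp
    then obtain i j where ij: "i < k" "j < k" "i \<noteq> j" "b i p p = 0" "b j p p = 0"
      using card_le_Suc0_iff_eq[of "{j. j < k \<and> b j p p = 0}"] by auto
    then obtain r where r: "r \<le> 3" "ordinary_mpoint ?f r (p $ 1) (p $ 2) (p $ 3)" using ord[OF p ij] by blast
    from ordinary_point_conics(1)[OF nd r(2)] show False using r(1) c by simp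
  qed
qed

section \<open>Counting syzygies\<close>

text \<open>Exponents of the first two coordinates in the monomials of degree \<open>n - 1\<close>.
  Because of the shift, \<open>tri 0\<close> is empty and stands for degree - 1, which occurs when
  the least syzygy degree is 1.\<close>

definition tri :: "nat \<Rightarrow> (nat \<times> nat) set" where
  "tri n = {(i, j). i + j < n}"

lemma tri_Sigma: "tri n = (SIGMA i:{..<n}. {..<n - i})"
  by (auto simp: tri_def)

lemma finite_tri: "finite (tri n)"
  by (simp add: tri_Sigma)

lemma card_tri: "2 * card (tri n) = n * (n + 1)"
proof -
  have "2 * (\<Sum>i<n. n - i) = n * (n + 1)"
    by (induction n) (simp_all add: sum.lessThan_Suc_shift del: sum.lessThan_Suc)
  then show ?thesis by (simp add: tri_Sigma)
qed

text \<open>Setting the third coordinate to 1 leaves distinct monomials in two variables, whose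
  coefficients are compared one variable at a time.\<close>

lemma monomials_independent:
  assumes zero: "\<And>v :: complex^3. (\<Sum>(i, j)\<in>tri n. x (i, j) * ((v $ 1)^i * (v $ 2)^j * (v $ 3)^(n - 1 - i - j))) = 0"
    and ij: "(i, j) \<in> tri n"
  shows "x (i, j) = 0"
proof -
  define y where "y = (\<lambda>i j. if (i, j) \<in> tri n then x (i, j) else 0)"
  have "(\<Sum>i\<le>n. (\<Sum>j\<le>n. y i j * t^j) * s^i) = 0" for s t
  proof -
    have "(\<Sum>i\<le>n. (\<Sum>j\<le>n. y i j * t^j) * s^i) = (\<Sum>i\<le>n. \<Sum>j\<le>n. y i j * (s^i * t^j))"
      by (simp add: sum_distrib_left sum_distrib_right mult_ac)
    also have "\<dots> = (\<Sum>(i, j)\<in>{..n} \<times> {..n}. y i j * (s^i * t^j))"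
      by (simp add: sum.cartesian_product)
    also have "\<dots> = (\<Sum>(i, j)\<in>tri n. x (i, j) * (s^i * t^j))"
      by (rule sum.mono_neutral_cong_right) (auto simp: y_def tri_def split: if_splits)
    also have "\<dots> = 0" using zero[of "vec3 s t 1"] by simp
    finally show ?thesis .
  qed
  then have "(\<Sum>j\<le>n. y i j * t^j) = 0" for t
    using polyfun_eq_0[of "\<lambda>i. \<Sum>j\<le>n. y i j * t^j" n] ij by (auto simp: tri_def)
  then have "y i j = 0" using polyfun_eq_0[of "y i" n] ij by (auto simp: tri_def)
  then show ?thesis using ij by (simp add: y_def)
qed

text \<open>The data of a nearly free curve, with the two syzygies of larger degree ordered such that the linear
  coefficient \<open>dot c\<close> of the first one in the unique relation is nonzero.\<close>

lemma nearly_free_generators: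
  assumes sb': "\<forall>i<k. symmetric_bilinear (b i)"
    and nf: "nearly_free (\<lambda>x y z. form_prod k b (vec3 x y z))"
  shows "\<exists>r \<rho>0 \<rho>1 \<rho>2 c \<alpha>0 \<alpha>2. 1 \<le> r \<and> r \<le> k \<and> c \<noteq> 0 \<and> (\<exists>v. form_prod k b v \<noteq> 0) \<and>
    (\<forall>l. hpoly r (\<lambda>v. \<rho>0 v $ l)) \<and> (\<forall>l. hpoly (2 * k - r) (\<lambda>v. \<rho>1 v $ l)) \<and> (\<forall>l. hpoly (2 * k - r) (\<lambda>v. \<rho>2 v $ l)) \<and>
    (\<forall>v. grad_form_prod k b v (\<rho>0 v) = 0 \<and> grad_form_prod k b v (\<rho>1 v) = 0 \<and> grad_form_prod k b v (\<rho>2 v) = 0) \<and>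
    (\<forall>V0 V1 V2 n0 n1 n2. hpoly n0 V0 \<longrightarrow> hpoly n1 V1 \<longrightarrow> hpoly n2 V2 \<longrightarrow>
      (\<forall>v. V0 v *s \<rho>0 v + V1 v *s \<rho>1 v + V2 v *s \<rho>2 v = 0) \<longrightarrow>
      (\<exists>w. \<forall>v. V0 v = \<alpha>0 v * w v \<and> V1 v = dot c v * w v \<and> V2 v = \<alpha>2 v * w v))"
proof -
  let ?f = "\<lambda>x y z. form_prod k b (vec3 x y z)"
  obtain d ds es where res: "syz_resolution ?f d 3 ds es"
    and ds: "ds 0 + ds 1 = d" "ds 1 = ds 2" and es: "es 0 = d + ds 1"
    using nf unfolding nearly_free_def by blast
  have sb: "symmetric_bilinear (b i)" if "i < k" for i using sb' that by blast
  have three: "(3::nat) - 2 = 1" by simp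
  have "d \<ge> 2 \<and> homog (int d) ?f \<and> ?f \<noteq> zero_pf \<and> (\<forall>i j. i \<le> j \<and> j < 3 \<longrightarrow> ds i \<le> ds j) \<and> 1 \<le> ds 0"
    using res unfolding syz_resolution_def by (elim conjE) simp
  then have d2: "d \<ge> 2" and hf: "homog (int d) ?f" and fnz: "?f \<noteq> zero_pf" and le: "ds 0 \<le> ds 1" and r1: "1 \<le> ds 0"
    by auto
  obtain A B where
      hB: "\<forall>l<3. \<forall>j<3. homog (int (ds j)) (B l j)"
    and hA: "\<forall>j<3. \<forall>i<1. homog (int (es i) - int (d - 1 + ds j)) (A j i)"
    and jB: "\<forall>j<3. (\<lambda>x y z. \<Sum>l<3. jac ?f l x y z * B l j x y z) = zero_pf"
    and BA: "\<forall>l<3. \<forall>i<1. mapply B 3 (\<lambda>j. A j i) l = zero_pf"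
    and ker: "\<forall>v\<in>vecs 3. (\<forall>l<3. mapply B 3 v l = zero_pf) \<longrightarrow> (\<exists>w\<in>vecs 1. \<forall>j<3. v j = mapply A 1 w j)"
    and inj: "\<forall>w\<in>vecs 1. (\<forall>j<3. mapply A 1 w j = zero_pf) \<longrightarrow> (\<forall>i<1. w i = zero_pf)"
    using res unfolding syz_resolution_def three by (elim conjE exE) (rule that)
  obtain v0 where v0: "form_prod k b v0 \<noteq> 0"
    using fnz by (auto simp: zero_pf_def fun_eq_iff)
  \<comment> \<open>The degree in \<open>nearly_free\<close> is existentially bound; scaling by 2 at
    a point where the product is nonzero determines it.\<close>
  have dk: "d = 2 * k"
  proof -
    have "hpoly d (form_prod k b)" using homog_imp_hp[OF hf] by (simp add: hp_def)
    from hpoly_scale[OF this, of 2 v0] hpoly_scale[OF hpoly_form_prod[of k b, OF sb], of 2 v0] v0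
    have "(2::complex) ^ d = 2 ^ (2 * k)" by simp
    then have "norm ((2::complex) ^ d) = norm ((2::complex) ^ (2 * k))" by (simp only:)
    then show ?thesis by (simp only: norm_power norm_numeral) simp
  qed
  define \<rho> where "\<rho> = (\<lambda>j (v :: complex^3). vec3 (B 0 j (v $ 1) (v $ 2) (v $ 3)) (B 1 j (v $ 1) (v $ 2) (v $ 3)) (B 2 j (v $ 1) (v $ 2) (v $ 3)))"
  have B\<rho>: "B 0 j (v $ 1) (v $ 2) (v $ 3) = \<rho> j v $ 1" "B 1 j (v $ 1) (v $ 2) (v $ 3) = \<rho> j v $ 2"
    "B 2 j (v $ 1) (v $ 2) (v $ 3) = \<rho> j v $ 3" "B (Suc 0) j (v $ 1) (v $ 2) (v $ 3) = \<rho> j v $ 2" for j v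
    by (simp_all add: \<rho>_def)
  have h\<rho>: "hpoly (ds j) (\<lambda>v. \<rho> j v $ l)" if j: "j < 3" for j l
  proof -
    have "hpoly (ds j) (\<lambda>v. B l' j (v $ 1) (v $ 2) (v $ 3))" if "l' < 3" for l'
      using homog_imp_hp[OF hB[rule_format, OF that j]] by (simp add: hp_def)
    from this[of 0] this[of 1] this[of 2] exhaust_3[of l] show ?thesis by (auto simp: B\<rho>)
  qed
  have g\<rho>: "grad_form_prod k b v (\<rho> j v) = 0" if "j < 3" for j v
  proof -
    have "(\<Sum>l<3. jac ?f l (v $ 1) (v $ 2) (v $ 3) * B l j (v $ 1) (v $ 2) (v $ 3)) = 0"
      using jB[rule_format, OF that] by (simp add: zero_pf_def fun_eq_iff)
    then show ?thesis
      using jac_form_prod[of k b "v $ 1" "v $ 2" "v $ 3" "\<lambda>l. B l j (v $ 1) (v $ 2) (v $ 3)", OF sb]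
      by (simp add: \<rho>_def)
  qed
  define a where "a = (\<lambda>j (v :: complex^3). A j 0 (v $ 1) (v $ 2) (v $ 3))"
  have exact: "\<exists>w. \<forall>j<3. \<forall>v. V j v = a j v * w v"
    if V: "\<And>j. j < 3 \<Longrightarrow> hpoly (n j) (V j)" and z: "\<And>v. V 0 v *s \<rho> 0 v + V 1 v *s \<rho> 1 v + V 2 v *s \<rho> 2 v = 0"
    for V :: "nat \<Rightarrow> complex^3 \<Rightarrow> complex" and n
  proof -
    define vv where "vv = (\<lambda>j x y z. V j (vec3 x y z))"
    have "vv \<in> vecs 3" using hpoly_polyS[OF V] by (auto simp: vecs_def vv_def)
    moreover have "mapply B 3 vv l = zero_pf" if "l < 3" for l
    proof -
      have "V 0 v * \<rho> 0 v $ i + V 1 v * \<rho> 1 v $ i + V 2 v * \<rho> 2 v $ i = 0" for v i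
        using z[of v] by (simp add: vec_eq_iff)
      from this[of "vec3 _ _ _" 1] this[of "vec3 _ _ _" 2] this[of "vec3 _ _ _" 3]
      have "\<forall>x y z. B 0 0 x y z * V 0 (vec3 x y z) + B 0 1 x y z * V 1 (vec3 x y z) + B 0 2 x y z * V 2 (vec3 x y z) = 0 \<and>
          B 1 0 x y z * V 0 (vec3 x y z) + B 1 1 x y z * V 1 (vec3 x y z) + B 1 2 x y z * V 2 (vec3 x y z) = 0 \<and>
          B 2 0 x y z * V 0 (vec3 x y z) + B 2 1 x y z * V 1 (vec3 x y z) + B 2 2 x y z * V 2 (vec3 x y z) = 0"
        by (simp add: \<rho>_def mult.commute)
      moreover have "l = 0 \<or> l = 1 \<or> l = 2" using that by auto
      ultimately show ?thesis
        by (auto simp: mapply_def zero_pf_def fun_eq_iff vv_def numeral_3_eq_3 numeral_2_eq_2)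
    qed
    ultimately obtain w where w: "\<And>j. j < 3 \<Longrightarrow> vv j = mapply A 1 w j" using ker by blast
    have "V j v = a j v * w 0 (v $ 1) (v $ 2) (v $ 3)" if "j < 3" for j v
    proof -
      have "vv j (v $ 1) (v $ 2) (v $ 3) = mapply A 1 w j (v $ 1) (v $ 2) (v $ 3)" using w[OF that] by simp
      then show ?thesis by (simp add: vv_def mapply_def a_def)
    qed
    then show ?thesis by (intro exI[of _ "\<lambda>v. w 0 (v $ 1) (v $ 2) (v $ 3)"]) auto
  qed
  \<comment> \<open>Otherwise the relation involves \<open>\<rho> 0\<close> alone, with a
    coefficient \<open>a 0\<close> that is nonzero by injectivity, so \<open>\<rho> 0\<close>
    vanishes. Then (1, 0, 0) is a relation, and exactness makes 1 a multiple of \<open>a 0\<close>,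
    a form of positive degree that vanishes at the origin.\<close>
  have "\<exists>s. (s = 1 \<or> s = 2) \<and> A s 0 \<noteq> zero_pf"
  proof (rule ccontr)
    assume "\<not> ?thesis"
    then have A12: "A 1 0 = zero_pf" "A 2 0 = zero_pf" by auto
    have deg: "int (es 0) - int (d - 1 + ds 0) = int (Suc (ds 1 - ds 0))" using es ds d2 le by simp
    have "homog (int (Suc (ds 1 - ds 0))) (A 0 0)" using hA[rule_format, of 0 0] unfolding deg by simp
    from homog_imp_hp[OF this] have ha: "hpoly (Suc (ds 1 - ds 0)) (a 0)"
      unfolding a_def hp_def by (simp only: nat_int of_nat_less_0_iff if_False)
    have "\<exists>v. a 0 v \<noteq> 0"
    proof (rule ccontr)
      assume "\<not> ?thesis"
      then have "A 0 0 x y z = 0" for x y z using a_def by (metis vec3_nth)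
      then have A0: "A 0 0 = zero_pf" by (simp add: zero_pf_def fun_eq_iff)
      let ?w = "\<lambda>i :: nat. (\<lambda>x y z. 1) :: pf"
      have "?w \<in> vecs 1" by (simp add: vecs_def polyS_const)
      moreover have "mapply A 1 ?w j = zero_pf" if "j < 3" for j
      proof -
        have "j = 0 \<or> j = 1 \<or> j = 2" using that by auto
        then have "A j 0 = zero_pf" using A0 A12 by auto
        then show ?thesis by (simp add: mapply_def zero_pf_def)
      qed
      ultimately have "?w 0 = zero_pf" using inj by blast
      then show False by (simp add: zero_pf_def fun_eq_iff)
    qed
    then obtain v1 where v1: "a 0 v1 \<noteq> 0" by blast
    have "a 0 v * \<rho> 0 v $ l = 0" for v l
    proof -
      have "B l' 0 (v $ 1) (v $ 2) (v $ 3) * a 0 v = 0" if "l' < 3" for l'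
      proof -
        have "mapply B 3 (\<lambda>j. A j 0) l' (v $ 1) (v $ 2) (v $ 3) = 0"
          using BA that by (simp add: zero_pf_def)
        then show ?thesis using A12 by (simp add: mapply_def numeral_3_eq_3 numeral_2_eq_2 zero_pf_def a_def)
      qed
      from this[of 0] this[of 1] this[of 2] exhaust_3[of l] show ?thesis by (auto simp: B\<rho>)
    qed
    then have "\<rho> 0 v $ l = 0" for v l
      using hpoly_mult_eq_zeroD[OF ha h\<rho>[of 0 l] _ v1] by simp
    then have \<rho>0: "\<rho> 0 v = 0" for v by (simp add: vec_eq_iff)
    have "\<exists>w. \<forall>j<3. \<forall>v. (if j = 0 then 1 else 0) = a j v * w v"
      by (rule exact[of "\<lambda>j. 0" "\<lambda>j v. if j = 0 then 1 else 0"]) (auto simp: \<rho>0 hpoly_const)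
    then obtain w where "\<forall>j<3. \<forall>v. (if j = 0 then 1 else 0) = a j v * w v" by blast
    from this[rule_format, of 0 0] have "1 = a 0 0 * w 0" by simp
    moreover have "a 0 0 = 0" using hpoly_scale[OF ha, of 0 0] by simp
    ultimately show False by simp
  qed
  then obtain s where s: "s = 1 \<or> s = 2" "A s 0 \<noteq> zero_pf" by blast
  define s' where "s' = 3 - s"
  have s3: "s < 3" "s' < 3" "ds s = 2 * k - ds 0" "ds s' = 2 * k - ds 0"
    using s(1) ds dk by (auto simp: s'_def)
  have "int (es 0) - int (d - 1 + ds s) = 1" using es ds d2 s(1) by auto
  then have "homog 1 (A s 0)" using hA[rule_format, of s 0] s3 by simp
  then obtain c where c: "\<And>v. a s v = dot c v" using homog_1_linear unfolding a_def by blast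
  have "c \<noteq> 0"
  proof
    assume "c = 0"
    then have "a s v = 0" for v using c by (simp add: dot_def)
    then have "A s 0 x y z = 0" for x y z using a_def by (metis vec3_nth)
    then show False using s(2) by (simp add: zero_pf_def fun_eq_iff)
  qed
  moreover have "\<exists>w. \<forall>v. V0 v = a 0 v * w v \<and> V1 v = dot c v * w v \<and> V2 v = a s' v * w v"
    if V: "hpoly n0 V0" "hpoly n1 V1" "hpoly n2 V2"
      and z: "\<forall>v. V0 v *s \<rho> 0 v + V1 v *s \<rho> s v + V2 v *s \<rho> s' v = 0" for V0 V1 V2 n0 n1 n2
  proof -
    have "\<exists>w. \<forall>j<3. \<forall>v. (if j = 0 then V0 else if j = s then V1 else V2) v = a j v * w v"
      by (rule exact[of "\<lambda>j. if j = 0 then n0 else if j = s then n1 else n2"])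
         (use V z s(1) in \<open>auto simp: s'_def add_ac\<close>)
    then obtain w where w: "\<And>j v. j < 3 \<Longrightarrow> (if j = 0 then V0 else if j = s then V1 else V2) v = a j v * w v" by blast
    have "V0 v = a 0 v * w v \<and> V1 v = dot c v * w v \<and> V2 v = a s' v * w v" for v
      using w[of 0 v] w[of s v] w[of s' v] s(1) s3 c[of v] by (auto simp: s'_def)
    then show ?thesis by blast
  qed
  moreover have "ds 0 \<le> k" using le ds(1) dk by simp
  ultimately show ?thesis
    using r1 v0 h\<rho>[of 0] h\<rho>[OF s3(1), unfolded s3(3)] h\<rho>[OF s3(2), unfolded s3(4)]
      g\<rho>[of 0] g\<rho>[OF s3(1)] g\<rho>[OF s3(2)]
    by (intro exI[of _ "ds 0"] exI[of _ "\<rho> 0"] exI[of _ "\<rho> s"] exI[of _ "\<rho> s'"] exI[of _ c] exI[of _ "a 0"] exI[of _ "a s'"]) auto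
qed

text \<open>With \<open>s = k - r\<close> the cardinality is k^2 - 1 + s (s - 1). The three summands
  count the coefficients of a syzygy of degree \<open>2 * k - 2\<close> along the three generators,
  the middle one in two variables only.\<close>

lemma card_syzygy_coefficients:
  assumes "1 \<le> r" "r \<le> k" "2 \<le> k"
  shows "k\<^sup>2 - 2 < card (tri (2 * k - 1 - r) <+> ({..<r - 1} <+> tri (r - 1)))"
proof -
  define a where "a = r - 1"
  define s where "s = k - r"
  have e: "r = a + 1" "k = a + 1 + s" "2 * k - 1 - r = a + 2 * s" using assms by (auto simp: a_def s_def)
  let ?n = "card (tri (a + 2 * s) <+> ({..<a} <+> tri a))"
  have "2 * ?n = 2 * card (tri (a + 2 * s)) + 2 * a + 2 * card (tri a)"
    by (simp add: card_Plus finite_tri)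
  then have "2 * ?n + 2 * s + 2 = 2 * k\<^sup>2 + 2 * s\<^sup>2"
    unfolding card_tri e by (simp add: power2_eq_square algebra_simps)
  moreover have "s \<le> s\<^sup>2" by (simp add: power2_eq_square)
  moreover have "k\<^sup>2 \<ge> 4" using power_mono[OF assms(3), of 2] by simp
  ultimately have "k\<^sup>2 - 2 < ?n" by linarith
  then show ?thesis unfolding e(3) a_def .
qed

lemma dot_sum_right: "dot v (\<Sum>t\<in>S. f t) = (\<Sum>t\<in>S. dot v (f t))"
  by (simp add: dot_def sum.distrib sum_distrib_left)

lemma dot_crs_rotate: "dot (crs p y) w = dot (crs w p) y"
  by (simp add: dot_def crs_def algebra_simps)

lemma hpoly_crs:
  assumes "\<And>l. hpoly n (\<lambda>v. t v $ l)"
  shows "hpoly (Suc n) (\<lambda>v. crs v (t v) $ l)"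
proof -
  have "hpoly (Suc n) (\<lambda>v. v $ i * t v $ j - v $ i' * t v $ j')" for i j i' j'
    by (intro hpoly_diff hpoly_coord assms)
  then show ?thesis using exhaust_3[of l] by (auto simp: crs_def)
qed

lemma tri_monomial_sum_hpoly:
  "hpoly (n - 1) (\<lambda>v. \<Sum>(i, j)\<in>tri n. x (i, j) * ((v $ 1)^i * (v $ 2)^j * (v $ 3)^(n - 1 - i - j)))"
proof -
  have "hpoly (n - 1) (\<lambda>v. case t of (i, j) \<Rightarrow> x (i, j) * ((v $ 1)^i * (v $ 2)^j * (v $ 3)^(n - 1 - i - j)))"
    if "t \<in> tri n" for t
  proof -
    obtain i j where t: "t = (i, j)" by (cases t)
    have "hpoly (i + j + (n - 1 - i - j)) (\<lambda>v. x (i, j) * ((v $ 1)^i * (v $ 2)^j * (v $ 3)^(n - 1 - i - j)))"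
      by (intro hpoly_cmult hpoly_mult hpoly_nth_power)
    moreover have "i + j + (n - 1 - i - j) = n - 1" using that t by (auto simp: tri_def)
    ultimately show ?thesis using t by simp
  qed
  then show ?thesis by (rule hpoly_sum)
qed

lemma not_nearly_free:
  assumes arr: "conic_arrangement k b" and k2: "k \<ge> 2"
  shows "\<not> nearly_free (\<lambda>x y z. form_prod k b (vec3 x y z))"
proof
  assume nf: "nearly_free (\<lambda>x y z. form_prod k b (vec3 x y z))"
  interpret conic_arrangement k b by fact
  have bil: "\<forall>i<k. symmetric_bilinear (b i)" using bilinear by blast
  obtain r \<rho>0 \<rho>1 \<rho>2 c \<alpha>0 \<alpha>2 v0 where r: "1 \<le> r" "r \<le> k" and c: "c \<noteq> 0" and fnz: "form_prod k b v0 \<noteq> 0"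
    and h0: "\<forall>l. hpoly r (\<lambda>v. \<rho>0 v $ l)" and h1: "\<forall>l. hpoly (2 * k - r) (\<lambda>v. \<rho>1 v $ l)"
    and h2: "\<forall>l. hpoly (2 * k - r) (\<lambda>v. \<rho>2 v $ l)"
    and syz: "\<forall>v. grad_form_prod k b v (\<rho>0 v) = 0 \<and> grad_form_prod k b v (\<rho>1 v) = 0 \<and> grad_form_prod k b v (\<rho>2 v) = 0"
    and exact: "\<forall>V0 V1 V2 n0 n1 n2. hpoly n0 V0 \<longrightarrow> hpoly n1 V1 \<longrightarrow> hpoly n2 V2 \<longrightarrow>
      (\<forall>v. V0 v *s \<rho>0 v + V1 v *s \<rho>1 v + V2 v *s \<rho>2 v = 0) \<longrightarrow>
      (\<exists>w. \<forall>v. V0 v = \<alpha>0 v * w v \<and> V1 v = dot c v * w v \<and> V2 v = \<alpha>2 v * w v)"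
    using nearly_free_generators[OF bil nf] by (elim exE conjE) (rule that)
  obtain E where E: "finite E" "card E \<le> k\<^sup>2 - 2" and test:
    "\<forall>W. (\<forall>l. hpoly (2 * k - 1) (\<lambda>v. W v $ l)) \<longrightarrow> (\<forall>v. dot (W v) v = 0) \<longrightarrow>
      (\<forall>i<k. \<forall>p. b i p p = 0 \<longrightarrow> (\<forall>j<k. j \<noteq> i \<longrightarrow> b j p p \<noteq> 0) \<longrightarrow>
        (\<exists>c. \<forall>w. dot (W p) w = c * b i p w)) \<longrightarrow>
      (\<forall>(p, w)\<in>E. dot (W p) w = 0) \<longrightarrow> (\<forall>v. W v = 0)"
    using tangent_field_test_set[OF k2] by (elim exE conjE) (rule that)
  \<comment> \<open>The relation has coefficient \<open>dot c\<close> at \<open>\<rho>1\<close>, so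
    modulo it the coordinate \<open>m\<close> can be eliminated from the coefficient of
    \<open>\<rho>1\<close>; the other two coordinates \<open>m1\<close>, \<open>m2\<close>
    remain.\<close>
  obtain m where m: "c $ m \<noteq> 0" using c by (auto simp: vec_eq_iff)
  obtain m1 m2 :: 3 where mm: "m1 \<noteq> m" "m2 \<noteq> m" "m1 \<noteq> m2"
  proof -
    consider "m = 1" | "m = 2" | "m = 3" using exhaust_3[of m] by blast
    then show ?thesis
      by cases (use that[of 2 3] that[of 1 3] that[of 1 2] in simp_all)
  qed
  \<comment> \<open>Each of \<open>a\<close> and \<open>e\<close> exceeds by one the degree of a
    coefficient, of \<open>\<rho>0\<close> and of \<open>\<rho>1\<close>, \<open>\<rho>2\<close>
    respectively, in a syzygy of degree \<open>2 * k - 2\<close>.\<close>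
  define a where "a = 2 * k - 1 - r"
  define e where "e = r - 1"
  define I where "I = tri a <+> ({..<e} <+> tri e)"
  define \<Theta> where "\<Theta> = case_sum
      (\<lambda>(i, j) v. ((v $ 1)^i * (v $ 2)^j * (v $ 3)^(a - 1 - i - j)) *s \<rho>0 v)
      (case_sum (\<lambda>i v. ((v $ m1)^i * (v $ m2)^(e - 1 - i)) *s \<rho>1 v)
      (\<lambda>(i, j) v. ((v $ 1)^i * (v $ 2)^j * (v $ 3)^(e - 1 - i - j)) *s \<rho>2 v))"
  have finI: "finite I" by (simp add: I_def finite_tri)
  have "card E < card I"
    using E(2) card_syzygy_coefficients[OF r k2] unfolding I_def a_def e_def by linarith
  from homogeneous_linear_system[OF E(1) finI this, of "\<lambda>(p, w) t. dot (crs p (\<Theta> t p)) w"]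
  obtain x where x: "\<exists>t\<in>I. x t \<noteq> 0"
    and xE: "\<forall>(p, w)\<in>E. (\<Sum>t\<in>I. x t * dot (crs p (\<Theta> t p)) w) = 0"
    by (auto simp: case_prod_unfold)
  define \<theta> where "\<theta> = (\<lambda>v. \<Sum>t\<in>I. x t *s \<Theta> t v)"
  define V0 where "V0 = (\<lambda>v :: complex^3. \<Sum>(i, j)\<in>tri a. x (Inl (i, j)) * ((v $ 1)^i * (v $ 2)^j * (v $ 3)^(a - 1 - i - j)))"
  define V1 where "V1 = (\<lambda>v :: complex^3. \<Sum>i<e. x (Inr (Inl i)) * ((v $ m1)^i * (v $ m2)^(e - 1 - i)))"
  define V2 where "V2 = (\<lambda>v :: complex^3. \<Sum>(i, j)\<in>tri e. x (Inr (Inr (i, j))) * ((v $ 1)^i * (v $ 2)^j * (v $ 3)^(e - 1 - i - j)))"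
  have \<theta>: "\<theta> v = V0 v *s \<rho>0 v + V1 v *s \<rho>1 v + V2 v *s \<rho>2 v" for v
    unfolding \<theta>_def I_def V0_def V1_def V2_def
    by (simp add: sum.Plus finite_tri \<Theta>_def vec.scale_sum_left case_prod_unfold add.assoc)
  have hV0: "hpoly (a - 1) V0" unfolding V0_def by (rule tri_monomial_sum_hpoly)
  have hV2: "hpoly (e - 1) V2" unfolding V2_def by (rule tri_monomial_sum_hpoly)
  have hV1: "hpoly (e - 1) V1" unfolding V1_def
  proof (rule hpoly_sum)
    fix i assume "i \<in> {..<e}"
    then have "e - 1 = i + (e - 1 - i)" by auto
    moreover have "hpoly (i + (e - 1 - i)) (\<lambda>v. x (Inr (Inl i)) * ((v $ m1)^i * (v $ m2)^(e - 1 - i)))"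
      by (intro hpoly_cmult hpoly_mult hpoly_nth_power)
    ultimately show "hpoly (e - 1) (\<lambda>v. x (Inr (Inl i)) * ((v $ m1)^i * (v $ m2)^(e - 1 - i)))" by simp
  qed
  have h\<theta>: "hpoly (2 * k - 2) (\<lambda>v. \<theta> v $ l)" for l
  proof -
    have "hpoly (2 * k - 2) (\<lambda>v. V0 v * \<rho>0 v $ l)"
    proof -
      have "a - 1 + r = 2 * k - 2" using r k2 by (auto simp: a_def)
      then show ?thesis using hpoly_mult[OF hV0, of r "\<lambda>v. \<rho>0 v $ l"] h0 by simp
    qed
    moreover have "hpoly (2 * k - 2) (\<lambda>v. V1 v * \<rho>1 v $ l + V2 v * \<rho>2 v $ l)"
    \<comment> \<open>For \<open>e = 0\<close> the truncated \<open>e - 1\<close> is not the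
      intended degree - 1, but both sums are then empty.\<close>
    proof (cases "e = 0")
      case True
      then show ?thesis by (simp add: V1_def V2_def tri_def hpoly_zero)
    next
      case False
      then have "e - 1 + (2 * k - r) = 2 * k - 2" using r k2 by (auto simp: e_def)
      then show ?thesis
        using hpoly_mult[OF hV1, of "2 * k - r" "\<lambda>v. \<rho>1 v $ l"] h1
          hpoly_mult[OF hV2, of "2 * k - r" "\<lambda>v. \<rho>2 v $ l"] h2
        by (intro hpoly_add) simp_all
    qed
    ultimately have "hpoly (2 * k - 2) (\<lambda>v. V0 v * \<rho>0 v $ l + (V1 v * \<rho>1 v $ l + V2 v * \<rho>2 v $ l))"
      by (rule hpoly_add)
    then show ?thesis by (simp add: \<theta> add.assoc)
  qed
  have g\<theta>: "grad_form_prod k b v (\<theta> v) = 0" for v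
    using syz by (simp add: \<theta> grad_form_prod_linear[of k b, OF bilinear])
  have "Suc (2 * k - 2) = 2 * k - 1" using k2 by simp
  then have W1: "\<forall>l. hpoly (2 * k - 1) (\<lambda>v. crs v (\<theta> v) $ l)" using hpoly_crs[OF h\<theta>] by simp
  have W2: "\<forall>v. dot (crs v (\<theta> v)) v = 0" by (simp add: dot_crs_self)
  have W3: "\<exists>c. \<forall>w. dot (crs p (\<theta> p)) w = c * b i p w"
    if i: "i < k" and p: "b i p p = 0" and others: "\<forall>j<k. j \<noteq> i \<longrightarrow> b j p p \<noteq> 0" for i p
  proof -
    interpret nondegenerate "b i" using nondegenerate i .
    obtain g where g: "\<And>w. dot g w = b i p w" using covector_form by blast
    have "(\<Prod>j\<in>{..<k} - {i}. b j p p) \<noteq> 0" using others by auto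
    then have "b i p (\<theta> p) = 0" using g\<theta>[of p] grad_form_prod_on_conic[of i k b p "\<theta> p", OF i p] by simp
    then have perp: "dot g p = 0" "dot g (\<theta> p) = 0" using g p by auto
    show ?thesis
    proof (cases "g = 0")
      case True
      then have "p = 0" using nondeg[of p] g by (auto simp: dot_def)
      then have "dot (crs p (\<theta> p)) w = 0 * b i p w" for w by (simp add: crs_def dot_def)
      then show ?thesis by blast
    next
      case False
      from crs_parallel[OF this perp] obtain c where "crs p (\<theta> p) = c *s g" by blast
      then have "dot (crs p (\<theta> p)) w = c * b i p w" for w by (simp add: dot_scale_left g)
      then show ?thesis by blast
    qed
  qed
  have W4: "\<forall>(p, w)\<in>E. dot (crs p (\<theta> p)) w = 0"
  proof -
    have "dot (crs p (\<theta> p)) w = (\<Sum>t\<in>I. x t * dot (crs p (\<Theta> t p)) w)" for p w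
      by (simp add: dot_crs_rotate[of p _ w] \<theta>_def dot_sum_right dot_scale_right)
    then show ?thesis using xE by auto
  qed
  have W0: "\<forall>v. crs v (\<theta> v) = 0"
    by (rule test[THEN spec, of "\<lambda>v. crs v (\<theta> v)", THEN mp, THEN mp, THEN mp, THEN mp])
       (use W1 W2 W3 W4 in blast)+
  \<comment> \<open>A vanishing cross product makes \<open>\<theta> v\<close> radial, say
    \<open>d *s v\<close>; Euler's identity turns the syzygy equation into
    \<open>d * form_prod k b v = 0\<close>.\<close>
  have "form_prod k b v * \<theta> v $ l = 0" for v l
  proof (cases "v = 0")
    case True
    have "(0::complex) ^ (2 * k) = 0" using k2 by (simp add: power_0_left)
    then have "form_prod k b 0 = 0"
      using hpoly_scale[OF hpoly_form_prod[of k b, OF bilinear], of 0 0] by (metis mult_zero_left vector_smult_lzero)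
    then show ?thesis using True by simp
  next
    case False
    then obtain d where d: "\<theta> v = d *s v" using crs_eq_zeroD W0 by blast
    then have "d * (2 * of_nat k * form_prod k b v) = 0"
      using g\<theta>[of v] grad_form_prod_linear(2)[of k b v d v, OF bilinear] by (simp add: grad_form_prod_self)
    then show ?thesis using k2 d by auto
  qed
  then have "\<theta> v $ l = 0" for v l
    using fnz hpoly_mult_eq_zeroD[OF hpoly_form_prod[of k b, OF bilinear] h\<theta>[of l]] by blast
  then have "\<forall>v. V0 v *s \<rho>0 v + V1 v *s \<rho>1 v + V2 v *s \<rho>2 v = 0"
    unfolding \<theta>[symmetric] by (simp add: vec_eq_iff)
  then obtain w where w: "\<And>v. V0 v = \<alpha>0 v * w v" "\<And>v. V1 v = dot c v * w v" "\<And>v. V2 v = \<alpha>2 v * w v"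
    using exact[rule_format, OF hV0 hV1 hV2] by blast
  have dotc: "dot c (axis m 1) = c $ m" using exhaust_3[of m] by (auto simp: dot_def axis_def)
  have V1: "V1 v = 0" for v
  proof -
    \<comment> \<open>The projection along axis \<open>m\<close> onto the kernel of
      \<open>dot c\<close>, where the relation forces \<open>V1\<close> to vanish; \<open>V1\<close>
      does not see the coordinate that is changed.\<close>
    define v' where "v' = v + (- dot c v / c $ m) *s axis m 1"
    have "dot c v' = 0" using m unfolding v'_def dot_add_right dot_scale_right dotc by simp
    then have "V1 v' = 0" using w(2) by simp
    moreover have "v' $ m1 = v $ m1" "v' $ m2 = v $ m2" using mm by (auto simp: v'_def axis_def)
    ultimately show ?thesis by (simp add: V1_def)
  qed
  have hc: "hpoly 1 (dot c)"
  proof -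
    have "hpoly 1 (\<lambda>v. c $ 1 * v $ 1 + c $ 2 * v $ 2 + c $ 3 * v $ 3)"
      by (intro hpoly_add hpoly_cmult hpoly_nth)
    then show ?thesis by (simp add: dot_def[abs_def])
  qed
  \<comment> \<open>Both sides are the same product with \<open>w\<close>; once \<open>V1\<close>
    vanishes, \<open>dot c\<close> can be cancelled as a nonzero form.\<close>
  have "dot c v * V0 v = \<alpha>0 v * V1 v" "dot c v * V2 v = \<alpha>2 v * V1 v" for v by (simp_all add: w)
  then have V02: "V0 v = 0" "V2 v = 0" for v
    using hpoly_mult_eq_zeroD[OF hc hV0, of "axis m 1" v] hpoly_mult_eq_zeroD[OF hc hV2, of "axis m 1" v] V1 dotc m by auto
  have "x (Inl (i, j)) = 0" if "(i, j) \<in> tri a" for i j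
    using monomials_independent[of "\<lambda>t. x (Inl t)" a i j] V02(1) that unfolding V0_def by blast
  moreover have "x (Inr (Inr (i, j))) = 0" if "(i, j) \<in> tri e" for i j
    using monomials_independent[of "\<lambda>t. x (Inr (Inr t))" e i j] V02(2) that unfolding V2_def by blast
  moreover have "x (Inr (Inl i)) = 0" if "i < e" for i
  proof -
    have "(\<Sum>i\<le>e - 1. x (Inr (Inl i)) * s ^ i) = 0" for s
    proof -
      have "{..e - 1} = {..<e}" using that by auto
      then show ?thesis using V1[of "s *s axis m1 1 + axis m2 1"] mm by (simp add: V1_def axis_def)
    qed
    then show ?thesis using polyfun_eq_0[of "\<lambda>i. x (Inr (Inl i))" "e - 1"] that by auto
  qed
  ultimately have "x t = 0" if "t \<in> I" for t using that unfolding I_def by auto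
  with x show False by blast
qed

theorem theorem2p1:
  fixes k :: nat and q :: "nat \<Rightarrow> pf"
  assumes "k \<ge> 2"
    and "\<forall>i<k. homog 2 (q i) \<and> smooth_curve (q i)"
    and "\<forall>i<k. \<forall>j<k. i \<noteq> j \<longrightarrow> \<not> (\<exists>c. \<forall>x y z. q i x y z = c * q j x y z)"
    and "\<forall>x y z. is_sing_point (\<lambda>x y z. \<Prod>i<k. q i x y z) x y z \<longrightarrow>
           is_node (\<lambda>x y z. \<Prod>i<k. q i x y z) x y z \<or>
           is_ordinary_triple_point (\<lambda>x y z. \<Prod>i<k. q i x y z) x y z"
  shows "\<not> nearly_free (\<lambda>x y z. \<Prod>i<k. q i x y z)"
proof -
  have "\<forall>i. \<exists>b. i < k \<longrightarrow> symmetric_bilinear b \<and> (\<forall>x y z. q i x y z = b (vec3 x y z) (vec3 x y z))"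
    using assms(2) homog_2_form by blast
  then obtain b where b: "\<And>i. i < k \<Longrightarrow> symmetric_bilinear (b i)"
    "\<And>i x y z. i < k \<Longrightarrow> q i x y z = b i (vec3 x y z) (vec3 x y z)" by metis
  have f: "(\<lambda>x y z. \<Prod>i<k. q i x y z) = (\<lambda>x y z. form_prod k b (vec3 x y z))"
    unfolding form_prod_def by (intro ext prod.cong) (auto simp: b(2))
  have "nondegenerate (b i)" if "i < k" for i
    using smooth_imp_nondegenerate[OF b(1)[OF that] b(2)[OF that]] assms(2) that by blast
  then have "conic_arrangement k b"
    by (rule conic_arrangementI) (use assms(4) in \<open>simp_all only: f\<close>)
  then show ?thesis unfolding f using not_nearly_free assms(1) by blast
qed

end
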